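(* Let $1\le p<\infty$, let $f\in B\mathcal S^p$ have a Fourier series of the symmetric form $(\ast)$ described in the context, and let $\varphi\in\Phi$, $\tau>0$, $v\in V(\tau)$. Then for every $n\in\mathbb N$ $$E_{\lambda_n}^p(f)_{B\mathcal S^p}\le\frac1{I_{n,\varphi,p}(\tau,v)}\int_0^{\tau}\omega_\varphi^p\Big(f,\frac t{\lambda_n}\Big)_{B\mathcal S^p}\mathrm dv(t),$$ where $$I_{n,\varphi,p}(\tau,v)=\inf_{k\in\mathbb N,\;k\ge n}\int_0^{\tau}\varphi^p\Big(\frac{\lambda_k t}{\lambda_n}\Big)\,\mathrm dv(t).$$ If, in addition, $\varphi$ is non-decreasing on $[0,\tau]$ and $$I_{n,\varphi,p}(\tau,v)=\int_0^{\tau}\varphi^p(t)\,\mathrm dv(t),$$ then this inequality cannot be improved, and therefore $$\sup_{f\in B\mathcal S^p,\ f\ne\mathrm{const}}\ \frac{E_{\lambda_n}(f)_{B\mathcal S^p}}{\Big(\int_0^{\tau}\omega_\varphi^p\big(f,\frac t{\lambda_n}\big)_{B\mathcal S^p}\mathrm dv(t)\Big)^{1/p}}=\Big(\int_0^{\tau}\varphi^p(t)\,\mathrm dv(t)\Big)^{-1/p}.$$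
   Context: A function $f:\mathbb R\to\mathbb C$, summable on each finite interval, is called $B$-almost periodic (Besicovitch almost periodic of order 1) if there are trigonometric sums $\tau_N(x)=\sum_{k=1}^{N}a_ke^{\mathrm i\mu_kx}$ ($\mu_k\in\mathbb R$, $a_k\in\mathbb C$) with $\lim_{N\to\infty}\limsup_{T\to\infty}\frac1{2T}\int_{-T}^{T}|f(x)-\tau_N(x)|\,\mathrm dx=0$. For such $f$ the mean value $M\{f\}=\lim_{T\to\infty}\frac1T\int_0^Tf(x)\,\mathrm dx$ exists, and $\lambda\mapsto M\{f(\cdot)e^{-\mathrm i\lambda\cdot}\}$ is non-zero for at most countably many $\lambda\in\mathbb R$ (the Fourier exponents of $f$); its values there are the Fourier coefficients of $f$. For $1\le p<\infty$, $B\mathcal S^p$ is the space of $B$-almost periodic functions whose Fourier coefficients have finite $\ell_p$-norm; this norm is denoted $\|f\|_{B\mathcal S^p}$. Functions with the same Fourier coefficients are identified. Only those functions of $B\mathcal S^p$ are considered whose sequence of Fourier exponents has its only limit point at infinity. For such $f$ the Fourier series is written in the symmetric form $$(\ast)\qquad S[f](x)=\sum_{k\in\mathbb Z}A_ke^{\mathrm i\lambda_kx},\quad A_k=A_k(f)=M\{f(\cdot)e^{-\mathrm i\lambda_k\cdot}\},$$ where $\lambda_0:=0$, $\lambda_{-k}=-\lambda_k$, $|A_k|+|A_{-k}|>0$, and $\lambda_{k+1}>\lambda_k>0$ for $k>0$. Best approximation: $E_{\lambda_n}(f)_{B\mathcal S^p}=\inf_{g\in G_{\lambda_n}}\|f-g\|_{B\mathcal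 S^p}$, where $G_{\lambda_n}$ is the set of $B$-almost periodic functions with all Fourier exponents in $(-\lambda_n,\lambda_n)$; one has $E_{\lambda_n}^p(f)_{B\mathcal S^p}=\sum_{|k|\ge n}|A_k(f)|^p$. $\Phi$ is the set of all continuous bounded non-negative even functions $\varphi$ on $\mathbb R$ with $\varphi(0)=0$ whose zero set $\{t\in\mathbb R:\varphi(t)=0\}$ has Lebesgue measure zero. The generalized modulus of smoothness is $$\omega_\varphi(f,\delta)_{B\mathcal S^p}=\sup_{|h|\le\delta}\Big(\sum_{k\in\mathbb Z}\varphi^p(\lambda_kh)|A_k(f)|^p\Big)^{1/p},\quad\delta\ge0.$$ $V(\tau)$ is the set of all bounded non-decreasing non-constant functions on $[0,\tau]$. The convention $0/0=0$ is used.
   Formalization: The first inequality excludes the case where both I_n and the integral of ω^p are 0 (v has only a jump at 0): there the right side is (1/0)·0, and with 0/0=0 the inequality would be false since E^p>0. *)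

theory Defs
  imports "HOL-Analysis.Analysis"
begin

section \<open>Besicovitch almost periodic functions\<close>

text \<open>
  The coefficients and frequencies of the approximating sums may change with \<open>N\<close>.  Since
  frequencies may be repeated, it makes no difference whether the sums are required to be the
  partial sums of one fixed series.
\<close>

definition B_almost_periodic :: "(real \<Rightarrow> complex) \<Rightarrow> bool" where
  "B_almost_periodic f \<longleftrightarrow>
     (\<forall>a b. f absolutely_integrable_on {a..b}) \<and>
     (\<exists>(a :: nat \<Rightarrow> nat \<Rightarrow> complex) (\<mu> :: nat \<Rightarrow> nat \<Rightarrow> real).
        (\<lambda>N. Limsup at_top (\<lambda>T::real. ereal (1 / (2 * T) *
               integral {-T..T} (\<lambda>x. norm (f x - (\<Sum>k=1..N. a N k * cis (\<mu> N k * x)))))))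
        \<longlonglongrightarrow> 0)"

definition mean_value :: "(real \<Rightarrow> complex) \<Rightarrow> complex" where
  "mean_value f = Lim at_top (\<lambda>T::real. (1 / T) *\<^sub>R integral {0..T} f)"

definition fourier_coeff :: "(real \<Rightarrow> complex) \<Rightarrow> real \<Rightarrow> complex" where
  "fourier_coeff f \<mu> = mean_value (\<lambda>x. f x * cis (- (\<mu> * x)))"

definition fourier_exponents :: "(real \<Rightarrow> complex) \<Rightarrow> real set" where
  "fourier_exponents f = {\<mu>. fourier_coeff f \<mu> \<noteq> 0}"

text \<open>Functions with the same Fourier coefficients are identified.\<close>

definition BS_eq :: "(real \<Rightarrow> complex) \<Rightarrow> (real \<Rightarrow> complex) \<Rightarrow> bool" where
  "BS_eq f g \<longleftrightarrow> (\<forall>\<mu>. fourier_coeff f \<mu> = fourier_coeff g \<mu>)"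

section \<open>The spaces and best approximations\<close>

definition BS_finite :: "real \<Rightarrow> (real \<Rightarrow> complex) \<Rightarrow> bool" where
  "BS_finite p f \<longleftrightarrow> (\<lambda>\<mu>. norm (fourier_coeff f \<mu>) powr p) summable_on fourier_exponents f"

definition BSp :: "real \<Rightarrow> (real \<Rightarrow> complex) set" where
  "BSp p = {f. B_almost_periodic f \<and> BS_finite p f}"

definition BS_norm :: "real \<Rightarrow> (real \<Rightarrow> complex) \<Rightarrow> ennreal" where
  "BS_norm p f =
     (if BS_finite p f
      then ennreal ((\<Sum>\<^sub>\<infinity>\<mu>\<in>fourier_exponents f. norm (fourier_coeff f \<mu>) powr p) powr (1 / p))
      else \<infinity>)"

definition G_space :: "real \<Rightarrow> (real \<Rightarrow> complex) set" where
  "G_space r = {g. B_almost_periodic g \<and> fourier_exponents g \<subseteq> {-r<..<r}}"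

text \<open>
  Members of \<open>G_space r\<close> need not lie in \<open>BSp p\<close>, so the norms under the infimum may be infinite.
  The infimum itself is finite for \<open>f \<in> BSp p\<close> and \<open>r > 0\<close>, as \<open>g = 0\<close> is admissible.
\<close>

definition best_approx :: "real \<Rightarrow> real \<Rightarrow> (real \<Rightarrow> complex) \<Rightarrow> real" where
  "best_approx p r f = enn2real (INF g\<in>G_space r. BS_norm p (\<lambda>x. f x - g x))"

section \<open>Symmetric Fourier series\<close>

definition symmetric_exponents :: "(int \<Rightarrow> real) \<Rightarrow> bool" where
  "symmetric_exponents lam \<longleftrightarrow>
     lam 0 = 0 \<and> (\<forall>k. lam (- k) = - lam k) \<and>
     (\<forall>k>0. 0 < lam k \<and> lam k < lam (k + 1)) \<and>
     filterlim lam at_top at_top"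

text \<open>
  \<open>BSp_within\<close>: all Fourier exponents lie among the \<open>lam k\<close> (some of these may be absent, so
  trigonometric polynomials and constants are included).  \<open>BSp_sym\<close>: for each \<open>k > 0\<close>
  at least one of \<open>lam k\<close>, \<open>lam (- k)\<close> is actually an exponent.
\<close>

definition BSp_within :: "real \<Rightarrow> (int \<Rightarrow> real) \<Rightarrow> (real \<Rightarrow> complex) set" where
  "BSp_within p lam = {f \<in> BSp p. fourier_exponents f \<subseteq> range lam}"

definition BSp_sym :: "real \<Rightarrow> (int \<Rightarrow> real) \<Rightarrow> (real \<Rightarrow> complex) set" where
  "BSp_sym p lam =
     {f \<in> BSp_within p lam.
        \<forall>k>0. norm (fourier_coeff f (lam k)) + norm (fourier_coeff f (lam (- k))) > 0}"

section \<open>Moduli of smoothness and weights\<close>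

definition Phi_class :: "(real \<Rightarrow> real) set" where
  "Phi_class =
     {\<phi>. continuous_on UNIV \<phi> \<and> bounded (range \<phi>) \<and> (\<forall>t. 0 \<le> \<phi> t) \<and>
          (\<forall>t. \<phi> (- t) = \<phi> t) \<and> \<phi> 0 = 0 \<and> {t. \<phi> t = 0} \<in> null_sets lebesgue}"

definition gen_modulus ::
  "(real \<Rightarrow> real) \<Rightarrow> real \<Rightarrow> (int \<Rightarrow> real) \<Rightarrow> (real \<Rightarrow> complex) \<Rightarrow> real \<Rightarrow> real" where
  "gen_modulus \<phi> p lam f \<delta> =
     (SUP h\<in>{h. \<bar>h\<bar> \<le> \<delta>}.
        (\<Sum>\<^sub>\<infinity>k\<in>UNIV. \<phi> (lam k * h) powr p * norm (fourier_coeff f (lam k)) powr p) powr (1 / p))"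

definition V_class :: "real \<Rightarrow> (real \<Rightarrow> real) set" where
  "V_class \<tau> = {v. mono_on {0..\<tau>} v \<and> bounded (v ` {0..\<tau>}) \<and> \<not> v constant_on {0..\<tau>}}"

text \<open>
  The Riemann--Stieltjes integral: limit of the sums over tagged divisions as the mesh tends
  to zero.  No one-sided continuity of the integrator is assumed; below, all integrands are
  continuous and the integrator is monotone, so that the integral exists.
\<close>

definition has_RS_integral ::
  "(real \<Rightarrow> real) \<Rightarrow> (real \<Rightarrow> real) \<Rightarrow> real \<Rightarrow> real \<Rightarrow> real \<Rightarrow> bool" where
  "has_RS_integral g v a b I \<longleftrightarrow>
     (\<forall>e>0. \<exists>d>0. \<forall>D. D tagged_division_of {a..b} \<and> (\<lambda>x. ball x d) fine D \<longrightarrow>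
        \<bar>(\<Sum>(x, K)\<in>D. g x * (v (Sup K) - v (Inf K))) - I\<bar> < e)"

definition RS_integral :: "(real \<Rightarrow> real) \<Rightarrow> (real \<Rightarrow> real) \<Rightarrow> real \<Rightarrow> real \<Rightarrow> real" where
  "RS_integral g v a b = (THE I. has_RS_integral g v a b I)"

definition I_const ::
  "nat \<Rightarrow> (real \<Rightarrow> real) \<Rightarrow> real \<Rightarrow> (int \<Rightarrow> real) \<Rightarrow> real \<Rightarrow> (real \<Rightarrow> real) \<Rightarrow> real" where
  "I_const n \<phi> p lam \<tau> v =
     (INF k\<in>{k::nat. n \<le> k}.
        RS_integral (\<lambda>t. \<phi> (lam (int k) * t / lam (int n)) powr p) v 0 \<tau>)"

definition modulus_integral ::
  "nat \<Rightarrow> (real \<Rightarrow> real) \<Rightarrow> real \<Rightarrow> (int \<Rightarrow> real) \<Rightarrow> real \<Rightarrow> (real \<Rightarrow> real) \<Rightarrow> (real \<Rightarrow> complex) \<Rightarrow> real"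
  where
  "modulus_integral n \<phi> p lam \<tau> v f =
     RS_integral (\<lambda>t. gen_modulus \<phi> p lam f (t / lam (int n)) powr p) v 0 \<tau>"

end

theory Submission
  imports Defs
begin

text \<open>
  All quantities in the theorem depend on \<open>f\<close> only through the numbers \<open>\<bar>A\<^sub>k\<bar>\<^sup>p\<close>, where \<open>A\<^sub>k\<close> is the
  Fourier coefficient at \<open>\<lambda>\<^sub>k\<close>.  An element of \<open>G_space (\<lambda>\<^sub>n)\<close> cannot change the \<open>A\<^sub>k\<close> with \<open>\<bar>k\<bar> \<ge> n\<close> and
  can cancel all others, so that \<open>E\<^sup>p = \<Sum>\<^bsub>\<bar>k\<bar>\<ge>n\<^esub> \<bar>A\<^sub>k\<bar>\<^sup>p\<close> (\<open>best_approx_powr\<close>).  For each such \<open>k\<close> the constant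
  \<open>I\<close> is at most the integral of \<open>\<phi>\<^sup>p(\<lambda>\<^sub>k t/\<lambda>\<^sub>n)\<close>.  Summing this against \<open>\<bar>A\<^sub>k\<bar>\<^sup>p\<close> bounds \<open>I E\<^sup>p\<close> by the integral
  of \<open>\<Sum> \<phi>\<^sup>p(\<lambda>\<^sub>k t/\<lambda>\<^sub>n) \<bar>A\<^sub>k\<bar>\<^sup>p\<close>, and the integrand is one of the values, at \<open>h = t/\<lambda>\<^sub>n\<close>, whose supremum is
  \<open>\<omega>\<^sup>p(f, t/\<lambda>\<^sub>n)\<close> (\<open>jackson_inequality\<close>).

  For non-decreasing \<open>\<phi>\<close> the exponential with frequency \<open>\<lambda>\<^sub>n\<close> turns every step into an equality when
  \<open>I\<close> is attained at \<open>k = n\<close>.  It has too few exponents to be in \<open>BSp_sym\<close>; adding all remaining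
  exponents with small, summable coefficients repairs this and changes the modulus integral
  arbitrarily little (\<open>near_extremal\<close>).  Both sharpness claims follow by passing to the limit.

  Behind this stand two pieces of analysis.  The Riemann--Stieltjes integral of a continuous function
  against a monotone one exists, wherever the latter jumps (\<open>has_RS_integral_RS_integral\<close>), and the
  modulus of smoothness is continuous (\<open>continuous_on_gen_modulus\<close>), so that it can be integrated.
  The Fourier coefficients of Besicovitch almost periodic functions exist as limits of means and are
  therefore additive (\<open>has_mean_fourier_coeff\<close>, \<open>fourier_coeff_diff\<close>), and every absolutely summable
  family of coefficients is attained (\<open>trig_series_int\<close>).
\<close>

section \<open>Riemann--Stieltjes integrals of continuous functions\<close>

definition RS_sum :: "(real \<Rightarrow> real) \<Rightarrow> (real \<Rightarrow> real) \<Rightarrow> (real \<times> real set) set \<Rightarrow> real" where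
  "RS_sum g v D = (\<Sum>(x, K)\<in>D. g x * (v (Sup K) - v (Inf K)))"

text \<open>
  The \<open>v\<close>-mass of the intersection of two intervals.  Clamping the end points of \<open>L\<close> into
  \<open>K\<close> gives the value 0 to disjoint intervals, so no common refinement of divisions (whose
  cells may be empty or degenerate) has to be formed.
\<close>

definition overlap :: "(real \<Rightarrow> real) \<Rightarrow> real set \<Rightarrow> real set \<Rightarrow> real" where
  "overlap v K L =
     v (max (Inf K) (min (Sup K) (Sup L))) - v (max (Inf K) (min (Sup K) (Inf L)))"

lemma tagged_division_of_realE:
  fixes a b :: real
  assumes "D tagged_division_of {a..b}" "(x, K) \<in> D"
  obtains c d where "K = {c..d}" "a \<le> c" "c \<le> x" "x \<le> d" "d \<le> b"
proof -
  have "x \<in> K" "K \<subseteq> {a..b}" "\<exists>c d. K = cbox c d"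
    using tagged_division_ofD[OF assms(1)] assms(2) by blast+
  then obtain c d where "K = {c..d}" "x \<in> {c..d}" "{c..d} \<subseteq> {a..b}" by auto
  then show thesis using that by force
qed

lemma overlap_commute:
  assumes "c \<le> d" "r \<le> s"
  shows "overlap v {c..d} {r..s} = overlap v {r..s} {c..d}"
  using assms by (auto simp: overlap_def max_def min_def)

lemma overlap_nonneg:
  assumes "mono_on {a..b} v" "a \<le> c" "c \<le> d" "d \<le> b" "r \<le> s"
  shows "0 \<le> overlap v {c..d} {r..s}"
proof -
  have "v (max c (min d r)) \<le> v (max c (min d s))"
    using assms by (intro mono_onD[OF assms(1)]) auto
  then show ?thesis using assms by (simp add: overlap_def)
qed

lemma overlap_disjoint:
  assumes "c \<le> d" "r \<le> s" "{c..d} \<inter> {r..s} = {}"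
  shows "overlap v {c..d} {r..s} = 0"
proof -
  have "d < r \<or> s < c"
  proof (rule ccontr)
    assume "\<not> (d < r \<or> s < c)"
    then have "max c r \<in> {c..d} \<inter> {r..s}" using assms by auto
    then show False using assms by auto
  qed
  then show ?thesis using assms by (auto simp: overlap_def max_def min_def)
qed

text \<open>
  The sum telescopes, because \<open>overlap v {c..d} L\<close> is the increment over \<open>L\<close> of the clamped
  function \<open>\<lambda>t. v (max c (min d t))\<close>.
\<close>

lemma sum_overlap:
  assumes D: "D tagged_division_of {a..b}" and "a \<le> c" "c \<le> d" "d \<le> b"
  shows "(\<Sum>(y, L)\<in>D. overlap v {c..d} L) = v d - v c"
proof -
  have "(\<Sum>(y, L)\<in>D. overlap v {c..d} L)
      = (\<Sum>(y, L)\<in>D. (\<lambda>t. v (max c (min d t))) (Sup L) - (\<lambda>t. v (max c (min d t))) (Inf L))"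
    using assms by (simp add: overlap_def)
  also have "\<dots> = v (max c (min d b)) - v (max c (min d a))"
    using additive_tagged_division_1[OF _ D, of "\<lambda>t. v (max c (min d t))"] assms by simp
  also have "\<dots> = v d - v c"
    using assms by (simp add: max_absorb1 max_absorb2 min_absorb1 min_absorb2)
  finally show ?thesis .
qed

text \<open>
  Overlaps refine both sums to the index set \<open>D \<times> E\<close>.  A pair of cells contributes only if the
  cells meet, and then their tags are closer than \<open>2 * d\<close>, whatever the jumps of \<open>v\<close> are.
\<close>

lemma RS_sum_close:
  assumes v: "mono_on {a..b} v" and ab: "a \<le> b"
    and D: "D tagged_division_of {a..b}" "(\<lambda>x. ball x d) fine D"
    and E: "E tagged_division_of {a..b}" "(\<lambda>x. ball x d) fine E"
    and g: "\<And>x y. x \<in> {a..b} \<Longrightarrow> y \<in> {a..b} \<Longrightarrow> \<bar>x - y\<bar> < 2 * d \<Longrightarrow> \<bar>g x - g y\<bar> \<le> e"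
  shows "\<bar>RS_sum g v D - RS_sum g v E\<bar> \<le> e * (v b - v a)"
proof -
  have sums_to: "RS_sum h v P = (\<Sum>p\<in>P. \<Sum>q\<in>Q. h (fst p) * overlap v (snd p) (snd q))"
    if P: "P tagged_division_of {a..b}" and Q: "Q tagged_division_of {a..b}" for h P Q
    unfolding RS_sum_def
  proof (rule sum.cong[OF refl], clarify)
    fix x K assume "(x, K) \<in> P"
    then obtain c d where K: "K = {c..d}" "a \<le> c" "c \<le> x" "x \<le> d" "d \<le> b"
      by (rule tagged_division_of_realE[OF P])
    have "(\<Sum>q\<in>Q. overlap v K (snd q)) = v d - v c"
      using sum_overlap[OF Q, of c d v] K by (simp add: split_def)
    then show "h x * (v (Sup K) - v (Inf K))
        = (\<Sum>q\<in>Q. h (fst (x, K)) * overlap v (snd (x, K)) (snd q))"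
      using K by (simp add: sum_distrib_left[symmetric])
  qed
  have commute: "overlap v (snd q) (snd p) = overlap v (snd p) (snd q)"
    if "p \<in> D" "q \<in> E" for p q
  proof -
    obtain x K where p: "p = (x, K)" by fastforce
    obtain y L where q: "q = (y, L)" by fastforce
    have mem: "(x, K) \<in> D" "(y, L) \<in> E" using that p q by auto
    obtain c1 d1 where "K = {c1..d1}" "c1 \<le> x" "x \<le> d1"
      by (rule tagged_division_of_realE[OF D(1) mem(1)])
    moreover obtain c2 d2 where "L = {c2..d2}" "c2 \<le> y" "y \<le> d2"
      by (rule tagged_division_of_realE[OF E(1) mem(2)])
    ultimately show ?thesis by (simp add: p q overlap_commute)
  qed
  have "RS_sum g v E = (\<Sum>p\<in>D. \<Sum>q\<in>E. g (fst q) * overlap v (snd q) (snd p))"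
    by (subst sum.swap) (rule sums_to[OF E(1) D(1)])
  also have "\<dots> = (\<Sum>p\<in>D. \<Sum>q\<in>E. g (fst q) * overlap v (snd p) (snd q))"
    by (intro sum.cong refl) (simp add: commute)
  finally have "RS_sum g v D - RS_sum g v E
      = (\<Sum>p\<in>D. \<Sum>q\<in>E. (g (fst p) - g (fst q)) * overlap v (snd p) (snd q))"
    by (simp add: sums_to[OF D(1) E(1)] sum_subtractf left_diff_distrib)
  also have "\<bar>\<dots>\<bar> \<le> (\<Sum>p\<in>D. \<Sum>q\<in>E. e * overlap v (snd p) (snd q))"
  proof (intro order_trans[OF sum_abs] sum_mono)
    fix p q assume "p \<in> D" "q \<in> E"
    moreover obtain x K where p: "p = (x, K)" by fastforce
    moreover obtain y L where q: "q = (y, L)" by fastforce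
    ultimately have mem: "(x, K) \<in> D" "(y, L) \<in> E" by auto
    obtain c1 d1 where K: "K = {c1..d1}" "a \<le> c1" "c1 \<le> x" "x \<le> d1" "d1 \<le> b"
      by (rule tagged_division_of_realE[OF D(1) mem(1)])
    obtain c2 d2 where L: "L = {c2..d2}" "a \<le> c2" "c2 \<le> y" "y \<le> d2" "d2 \<le> b"
      by (rule tagged_division_of_realE[OF E(1) mem(2)])
    have nn: "0 \<le> overlap v K L"
      using overlap_nonneg[OF v, of c1 d1 c2 d2] K L by simp
    have "\<bar>(g x - g y) * overlap v K L\<bar> \<le> e * overlap v K L"
    proof (cases "K \<inter> L = {}")
      case True
      then show ?thesis using overlap_disjoint[of c1 d1 c2 d2 v] K L by simp
    next
      case False
      then obtain z where z: "z \<in> K" "z \<in> L" by auto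
      have "z \<in> ball x d" "z \<in> ball y d"
        using z mem D(2) E(2) unfolding fine_def by blast+
      then have "\<bar>x - y\<bar> < 2 * d" by (auto simp: dist_real_def)
      then have "\<bar>g x - g y\<bar> \<le> e" using g K L by auto
      then show ?thesis using nn by (simp add: abs_mult mult_right_mono)
    qed
    then show "\<bar>(g (fst p) - g (fst q)) * overlap v (snd p) (snd q)\<bar>
        \<le> e * overlap v (snd p) (snd q)"
      by (simp add: p q)
  qed
  also have "\<dots> = RS_sum (\<lambda>_. e) v D"
    by (simp add: sums_to[OF D(1) E(1)])
  also have "\<dots> = e * (v b - v a)"
    using additive_tagged_division_1[OF ab D(1), of v]
    by (simp add: RS_sum_def split_def sum_distrib_left[symmetric])
  finally show ?thesis .
qed

lemma ball_fine_mono: "(\<lambda>x. ball x d) fine D \<Longrightarrow> d \<le> e \<Longrightarrow> (\<lambda>x. ball x e) fine D"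
  for D :: "(real \<times> real set) set"
  unfolding fine_def using subset_ball by fastforce

lemma has_RS_integral_iff:
  "has_RS_integral g v a b I \<longleftrightarrow>
     (\<forall>e>0. \<exists>d>0. \<forall>D. D tagged_division_of {a..b} \<and> (\<lambda>x. ball x d) fine D \<longrightarrow>
        \<bar>RS_sum g v D - I\<bar> < e)"
  by (simp add: has_RS_integral_def RS_sum_def)

text \<open>
  A single sequence of divisions, chosen independently of integrand and integrator.  All integrals
  are limits along it, so linearity and monotonicity reduce to the same properties of finite sums.
\<close>

definition fine_division :: "real \<Rightarrow> real \<Rightarrow> nat \<Rightarrow> (real \<times> real set) set" where
  "fine_division a b N =
     (SOME D. D tagged_division_of {a..b} \<and> (\<lambda>x. ball x (inverse (real (Suc N)))) fine D)"

lemma fine_division: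
  shows "fine_division a b N tagged_division_of {a..b}"
    and "(\<lambda>x. ball x (inverse (real (Suc N)))) fine fine_division a b N"
proof -
  have "gauge (\<lambda>x::real. ball x (inverse (real (Suc N))))"
    by (simp add: gauge_def)
  then have "\<exists>D. D tagged_division_of {a..b} \<and> (\<lambda>x. ball x (inverse (real (Suc N)))) fine D"
    using fine_division_exists_real by metis
  from someI_ex[OF this]
  show "fine_division a b N tagged_division_of {a..b}"
    and "(\<lambda>x. ball x (inverse (real (Suc N)))) fine fine_division a b N"
    by (auto simp: fine_division_def)
qed

lemma has_RS_integral_tendsto:
  assumes "has_RS_integral g v a b I"
  shows "(\<lambda>N. RS_sum g v (fine_division a b N)) \<longlonglongrightarrow> I"
proof (rule tendstoI)
  fix e :: real assume "0 < e"
  then obtain d where d: "0 < d" "\<And>D. D tagged_division_of {a..b} \<Longrightarrow>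
      (\<lambda>x. ball x d) fine D \<Longrightarrow> \<bar>RS_sum g v D - I\<bar> < e"
    using assms unfolding has_RS_integral_iff by metis
  have "\<forall>\<^sub>F N in sequentially. inverse (real (Suc N)) < d"
    using LIMSEQ_inverse_real_of_nat d(1) by (rule order_tendstoD)
  then show "\<forall>\<^sub>F N in sequentially. dist (RS_sum g v (fine_division a b N)) I < e"
  proof eventually_elim
    case (elim N)
    then show ?case
      using d(2)[OF fine_division(1)] ball_fine_mono[OF fine_division(2), of N d]
      by (simp add: dist_real_def)
  qed
qed

lemma RS_integral_eqI: "has_RS_integral g v a b I \<Longrightarrow> RS_integral g v a b = I"
  unfolding RS_integral_def
  by (blast intro: the_equality LIMSEQ_unique has_RS_integral_tendsto)

text \<open>
  By uniform continuity of the integrand, \<open>RS_sum_close\<close> is the Cauchy criterion for the net of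
  Riemann--Stieltjes sums.
\<close>

lemma has_RS_integral_RS_integral:
  assumes v: "mono_on {a..b} v" and ab: "a \<le> b" and g: "continuous_on {a..b} g"
  shows "has_RS_integral g v a b (RS_integral g v a b)"
proof -
  \<comment> \<open>The summand 1 keeps the divisor positive when \<open>v a = v b\<close>.\<close>
  let ?V = "v b - v a + 1"
  have V: "0 < ?V" using mono_onD[OF v, of a b] ab by simp
  have close: "\<exists>d>0. \<forall>D E. D tagged_division_of {a..b} \<and> (\<lambda>x. ball x d) fine D \<and>
        E tagged_division_of {a..b} \<and> (\<lambda>x. ball x d) fine E \<longrightarrow>
        \<bar>RS_sum g v D - RS_sum g v E\<bar> < e" if "0 < e" for e
  proof -
    have "uniformly_continuous_on {a..b} g"
      using g by (simp add: compact_uniformly_continuous)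
    moreover have "0 < e / ?V" using that V by simp
    ultimately obtain d where d: "0 < d" "\<And>x y. x \<in> {a..b} \<Longrightarrow> y \<in> {a..b} \<Longrightarrow>
        dist y x < d \<Longrightarrow> dist (g y) (g x) < e / ?V"
      unfolding uniformly_continuous_on_def by metis
    have "\<bar>RS_sum g v D - RS_sum g v E\<bar> < e"
      if "D tagged_division_of {a..b}" "(\<lambda>x. ball x (d / 2)) fine D"
        "E tagged_division_of {a..b}" "(\<lambda>x. ball x (d / 2)) fine E" for D E
    proof -
      have "\<bar>RS_sum g v D - RS_sum g v E\<bar> \<le> e / ?V * (v b - v a)"
        using that d by (intro RS_sum_close[OF v ab, where d = "d / 2"])
          (auto simp: dist_real_def abs_minus_commute intro!: less_imp_le)
      also have "\<dots> < e" using \<open>0 < e\<close> V by (simp add: field_simps)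
      finally show ?thesis .
    qed
    then show ?thesis using d(1) by (intro exI[of _ "d / 2"]) auto
  qed
  have "Cauchy (\<lambda>N. RS_sum g v (fine_division a b N))"
    unfolding Cauchy_def
  proof (intro allI impI)
    fix e :: real assume "0 < e"
    from close[OF this] obtain d where d: "0 < d" "\<And>D E. D tagged_division_of {a..b} \<Longrightarrow>
        (\<lambda>x. ball x d) fine D \<Longrightarrow> E tagged_division_of {a..b} \<Longrightarrow> (\<lambda>x. ball x d) fine E \<Longrightarrow>
        \<bar>RS_sum g v D - RS_sum g v E\<bar> < e" by metis
    have "\<forall>\<^sub>F N in sequentially. inverse (real (Suc N)) < d"
      using LIMSEQ_inverse_real_of_nat d(1) by (rule order_tendstoD)
    then obtain M where M: "\<And>N. N \<ge> M \<Longrightarrow> inverse (real (Suc N)) < d"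
      unfolding eventually_sequentially by blast
    then have "(\<lambda>x. ball x d) fine fine_division a b N" if "N \<ge> M" for N
      using ball_fine_mono[OF fine_division(2)] that by (simp add: less_imp_le)
    then show "\<exists>M. \<forall>m\<ge>M. \<forall>n\<ge>M.
        dist (RS_sum g v (fine_division a b m)) (RS_sum g v (fine_division a b n)) < e"
      by (intro exI[of _ M]) (simp add: dist_real_def d(2) fine_division(1))
  qed
  then obtain I where I: "(\<lambda>N. RS_sum g v (fine_division a b N)) \<longlonglongrightarrow> I"
    using Cauchy_convergent_iff convergent_def by blast
  have "has_RS_integral g v a b I"
    unfolding has_RS_integral_iff
  proof (intro allI impI)
    fix e :: real assume "0 < e"
    then have e2: "0 < e / 2" by simp
    from close[OF this] obtain d where d: "0 < d" "\<And>D E. D tagged_division_of {a..b} \<Longrightarrow>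
        (\<lambda>x. ball x d) fine D \<Longrightarrow> E tagged_division_of {a..b} \<Longrightarrow> (\<lambda>x. ball x d) fine E \<Longrightarrow>
        \<bar>RS_sum g v D - RS_sum g v E\<bar> < e / 2" by metis
    have "\<forall>\<^sub>F N in sequentially. inverse (real (Suc N)) < d"
      using LIMSEQ_inverse_real_of_nat d(1) by (rule order_tendstoD)
    moreover have "\<forall>\<^sub>F N in sequentially. dist (RS_sum g v (fine_division a b N)) I < e / 2"
      using I e2 by (rule tendstoD)
    ultimately have "\<forall>\<^sub>F N in sequentially. inverse (real (Suc N)) < d \<and>
        dist (RS_sum g v (fine_division a b N)) I < e / 2" by (rule eventually_conj)
    then obtain N where N: "inverse (real (Suc N)) < d"
        "dist (RS_sum g v (fine_division a b N)) I < e / 2"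
      using eventually_happens trivial_limit_sequentially by blast
    have "\<bar>RS_sum g v D - I\<bar> < e"
      if "D tagged_division_of {a..b}" "(\<lambda>x. ball x d) fine D" for D
    proof -
      have "\<bar>RS_sum g v D - RS_sum g v (fine_division a b N)\<bar> < e / 2"
        using d(2)[OF that fine_division(1) ball_fine_mono[OF fine_division(2)]] N(1) by simp
      moreover have "\<bar>RS_sum g v (fine_division a b N) - I\<bar> < e / 2"
        using N(2) by (simp add: dist_real_def)
      ultimately show ?thesis by linarith
    qed
    then show "\<exists>d>0. \<forall>D. D tagged_division_of {a..b} \<and> (\<lambda>x. ball x d) fine D \<longrightarrow>
        \<bar>RS_sum g v D - I\<bar> < e"
      using d(1) by blast
  qed
  then show ?thesis by (simp add: RS_integral_eqI)
qed

lemmas RS_integral_tendsto =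
  has_RS_integral_tendsto[OF has_RS_integral_RS_integral]

lemma RS_integral_mono:
  assumes v: "mono_on {a..b} v" and ab: "a \<le> b"
    and g: "continuous_on {a..b} g" and h: "continuous_on {a..b} h"
    and le: "\<And>x. x \<in> {a..b} \<Longrightarrow> g x \<le> h x"
  shows "RS_integral g v a b \<le> RS_integral h v a b"
proof (rule LIMSEQ_le[OF RS_integral_tendsto[OF v ab g] RS_integral_tendsto[OF v ab h]],
    intro exI allI impI)
  fix N
  show "RS_sum g v (fine_division a b N) \<le> RS_sum h v (fine_division a b N)"
    unfolding RS_sum_def
  proof (rule sum_mono, clarify)
    fix x K assume "(x, K) \<in> fine_division a b N"
    then obtain c d where K: "K = {c..d}" "a \<le> c" "c \<le> x" "x \<le> d" "d \<le> b"
      by (rule tagged_division_of_realE[OF fine_division(1)])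
    then have "v c \<le> v d" by (intro mono_onD[OF v]) auto
    then show "g x * (v (Sup K) - v (Inf K)) \<le> h x * (v (Sup K) - v (Inf K))"
      using K le[of x] by (simp add: mult_right_mono)
  qed
qed

lemma RS_integral_cmult:
  assumes v: "mono_on {a..b} v" and ab: "a \<le> b" and g: "continuous_on {a..b} g"
  shows "RS_integral (\<lambda>x. c * g x) v a b = c * RS_integral g v a b"
proof (rule LIMSEQ_unique)
  show "(\<lambda>N. RS_sum (\<lambda>x. c * g x) v (fine_division a b N))
      \<longlonglongrightarrow> RS_integral (\<lambda>x. c * g x) v a b"
    by (intro RS_integral_tendsto v ab continuous_intros g)
  show "(\<lambda>N. RS_sum (\<lambda>x. c * g x) v (fine_division a b N)) \<longlonglongrightarrow> c * RS_integral g v a b"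
    using tendsto_mult_left[OF RS_integral_tendsto[OF v ab g], of c]
    by (simp add: RS_sum_def sum_distrib_left split_def mult.assoc)
qed

lemma RS_integral_sum:
  assumes v: "mono_on {a..b} v" and ab: "a \<le> b"
    and g: "\<And>i. i \<in> S \<Longrightarrow> continuous_on {a..b} (g i)"
  shows "RS_integral (\<lambda>x. \<Sum>i\<in>S. g i x) v a b = (\<Sum>i\<in>S. RS_integral (g i) v a b)"
proof (rule LIMSEQ_unique)
  show "(\<lambda>N. RS_sum (\<lambda>x. \<Sum>i\<in>S. g i x) v (fine_division a b N))
      \<longlonglongrightarrow> RS_integral (\<lambda>x. \<Sum>i\<in>S. g i x) v a b"
    by (intro RS_integral_tendsto v ab continuous_intros g)
  have "(\<lambda>N. \<Sum>i\<in>S. RS_sum (g i) v (fine_division a b N))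
      \<longlonglongrightarrow> (\<Sum>i\<in>S. RS_integral (g i) v a b)"
    by (intro tendsto_sum RS_integral_tendsto v ab g)
  moreover have "(\<Sum>i\<in>S. RS_sum (g i) v D) = RS_sum (\<lambda>x. \<Sum>i\<in>S. g i x) v D" for D
    unfolding RS_sum_def split_def sum_distrib_right by (rule sum.swap)
  ultimately show "(\<lambda>N. RS_sum (\<lambda>x. \<Sum>i\<in>S. g i x) v (fine_division a b N))
      \<longlonglongrightarrow> (\<Sum>i\<in>S. RS_integral (g i) v a b)" by simp
qed

lemma RS_integral_add_const:
  assumes v: "mono_on {a..b} v" and ab: "a \<le> b" and g: "continuous_on {a..b} g"
  shows "RS_integral (\<lambda>x. g x + c) v a b = RS_integral g v a b + c * (v b - v a)"
proof (rule LIMSEQ_unique)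
  show "(\<lambda>N. RS_sum (\<lambda>x. g x + c) v (fine_division a b N))
      \<longlonglongrightarrow> RS_integral (\<lambda>x. g x + c) v a b"
    by (intro RS_integral_tendsto v ab continuous_intros g)
  have "RS_sum (\<lambda>x. g x + c) v D = RS_sum g v D + c * (v b - v a)"
    if "D tagged_division_of {a..b}" for D
    using additive_tagged_division_1[OF ab that, of v]
    by (simp add: RS_sum_def split_def distrib_right sum.distrib sum_distrib_left[symmetric])
  then show "(\<lambda>N. RS_sum (\<lambda>x. g x + c) v (fine_division a b N))
      \<longlonglongrightarrow> RS_integral g v a b + c * (v b - v a)"
    using tendsto_add[OF RS_integral_tendsto[OF v ab g] tendsto_const]
    by (simp add: fine_division)
qed

lemma RS_integral_nonneg:
  assumes "mono_on {a..b} v" "a \<le> b" "continuous_on {a..b} g" "\<And>x. x \<in> {a..b} \<Longrightarrow> 0 \<le> g x"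
  shows "0 \<le> RS_integral g v a b"
  using RS_integral_mono[OF assms(1,2) continuous_on_const assms(3,4)]
    RS_integral_cmult[OF assms(1-3), of 0] by simp

section \<open>Mean values and Fourier coefficients\<close>

definition has_mean :: "(real \<Rightarrow> complex) \<Rightarrow> complex \<Rightarrow> bool" where
  "has_mean f m \<longleftrightarrow> ((\<lambda>T::real. (1 / T) *\<^sub>R integral {0..T} f) \<longlongrightarrow> m) at_top"

lemma mean_value_eqI: "has_mean f m \<Longrightarrow> mean_value f = m"
  unfolding has_mean_def mean_value_def by (rule tendsto_Lim) simp

lemma has_mean_cis: "has_mean (\<lambda>x. cis (\<nu> * x)) (if \<nu> = 0 then 1 else 0)"
proof (cases "\<nu> = 0")
  case True
  have "\<forall>\<^sub>F T::real in at_top. (1 / T) *\<^sub>R integral {0..T} (\<lambda>x. cis (\<nu> * x)) = 1"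
    using eventually_gt_at_top[of 0] by eventually_elim (simp add: True scaleR_conv_of_real)
  then show ?thesis using True by (simp add: has_mean_def tendsto_eventually)
next
  case False
  have bound: "norm ((1 / T) *\<^sub>R integral {0..T} (\<lambda>x. cis (\<nu> * x))) \<le> 2 / \<bar>\<nu>\<bar> * inverse T"
    if "0 < T" for T
  proof -
    let ?F = "\<lambda>x. cis (\<nu> * x) / (\<i> * complex_of_real \<nu>)"
    have "((\<lambda>x. cis (\<nu> * x)) has_integral (?F T - ?F 0)) {0..T}"
    proof (intro fundamental_theorem_of_calculus less_imp_le that)
      fix x
      show "(?F has_vector_derivative cis (\<nu> * x)) (at x within {0..T})"
        unfolding has_vector_derivative_def divide_inverse
        by (rule derivative_eq_intros refl)+
          (use False in \<open>simp add: fun_eq_iff scaleR_conv_of_real field_simps\<close>)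
    qed
    then have "integral {0..T} (\<lambda>x. cis (\<nu> * x)) = ?F T - ?F 0"
      by (rule integral_unique)
    moreover have "norm (?F T - ?F 0) \<le> 1 / \<bar>\<nu>\<bar> + 1 / \<bar>\<nu>\<bar>"
      by (intro order_trans[OF norm_triangle_ineq4]) (simp add: norm_divide norm_mult)
    ultimately have "norm (integral {0..T} (\<lambda>x. cis (\<nu> * x))) \<le> 2 / \<bar>\<nu>\<bar>" by simp
    then have "inverse T * norm (integral {0..T} (\<lambda>x. cis (\<nu> * x))) \<le> inverse T * (2 / \<bar>\<nu>\<bar>)"
      using that by (intro mult_left_mono) auto
    then show ?thesis using that by (simp add: divide_inverse mult_ac)
  qed
  have "\<forall>\<^sub>F T in at_top. norm ((1 / T) *\<^sub>R integral {0..T} (\<lambda>x. cis (\<nu> * x))) \<le> 2 / \<bar>\<nu>\<bar> * inverse T"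
    using eventually_gt_at_top[of 0] by (rule eventually_mono) (rule bound)
  moreover have "((\<lambda>T. 2 / \<bar>\<nu>\<bar> * inverse T) \<longlongrightarrow> 0) at_top"
    using tendsto_mult_left[OF tendsto_inverse_0_at_top[OF filterlim_ident], of "2 / \<bar>\<nu>\<bar>"]
    by simp
  ultimately have "((\<lambda>T. (1 / T) *\<^sub>R integral {0..T} (\<lambda>x. cis (\<nu> * x))) \<longlongrightarrow> 0) at_top"
    by (rule Lim_null_comparison)
  then show ?thesis using False by (simp add: has_mean_def)
qed

lemma has_mean_diff:
  assumes "has_mean f m" "has_mean g k"
    and "\<And>T. f integrable_on {0..T}" "\<And>T. g integrable_on {0..T}"
  shows "has_mean (\<lambda>x. f x - g x) (m - k)"
  using tendsto_diff[OF assms(1,2)[unfolded has_mean_def]] assms(3,4)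
  by (simp add: has_mean_def integral_diff scaleR_diff_right)

lemma has_mean_trig_sum:
  assumes "finite S"
  shows "has_mean (\<lambda>x. \<Sum>k\<in>S. a k * cis (\<mu> k * x)) (\<Sum>k\<in>S. if \<mu> k = 0 then a k else 0)"
proof -
  have cont: "continuous_on A (\<lambda>x. cis (\<mu> k * x))" for A k
    by (intro continuous_intros)
  have "((\<lambda>T. \<Sum>k\<in>S. a k * ((1 / T) *\<^sub>R integral {0..T} (\<lambda>x. cis (\<mu> k * x))))
      \<longlongrightarrow> (\<Sum>k\<in>S. a k * (if \<mu> k = 0 then 1 else 0))) at_top"
    by (intro tendsto_sum tendsto_mult_left has_mean_cis[unfolded has_mean_def])
  moreover have "(1 / T) *\<^sub>R integral {0..T} (\<lambda>x. \<Sum>k\<in>S. a k * cis (\<mu> k * x))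
      = (\<Sum>k\<in>S. a k * ((1 / T) *\<^sub>R integral {0..T} (\<lambda>x. cis (\<mu> k * x))))" for T
  proof -
    have "integral {0..T} (\<lambda>x. \<Sum>k\<in>S. a k * cis (\<mu> k * x))
        = (\<Sum>k\<in>S. integral {0..T} (\<lambda>x. a k * cis (\<mu> k * x)))"
      by (intro integral_sum assms integrable_continuous_interval continuous_intros)
    then show ?thesis by (simp add: scaleR_sum_right mult_scaleR_right)
  qed
  moreover have "(\<Sum>k\<in>S. a k * (if \<mu> k = 0 then 1 else 0))
      = (\<Sum>k\<in>S. if \<mu> k = 0 then a k else 0)"
    by (intro sum.cong) auto
  ultimately show ?thesis by (simp add: has_mean_def)
qed

text \<open>
  The mean values exist because those of trigonometric sums do.  The next two lemmas are the
  principle behind this: limits pass to functions that are, eventually along the filter,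
  arbitrarily close to functions with known limits.
\<close>

lemma tendsto_of_close:
  fixes F :: "'a \<Rightarrow> 'b::metric_space"
  assumes "\<And>e. 0 < e \<Longrightarrow> \<exists>G l'. (G \<longlongrightarrow> l') \<F> \<and> dist l' l < e \<and> (\<forall>\<^sub>F x in \<F>. dist (F x) (G x) < e)"
  shows "(F \<longlongrightarrow> l) \<F>"
proof (rule tendstoI)
  fix e :: real assume "0 < e"
  then have e: "0 < e / 3" by simp
  from assms[OF this] obtain G l' where G: "(G \<longlongrightarrow> l') \<F>" "dist l' l < e / 3"
    "\<forall>\<^sub>F x in \<F>. dist (F x) (G x) < e / 3" by blast
  from G(3) tendstoD[OF G(1) e] show "\<forall>\<^sub>F x in \<F>. dist (F x) l < e"
  proof eventually_elim
    case (elim x)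
    have "dist (F x) l \<le> dist (F x) (G x) + (dist (G x) l' + dist l' l)"
      by (rule order_trans[OF dist_triangle[of _ _ "G x"] add_left_mono[OF dist_triangle]])
    then show ?case using elim G(2) by simp
  qed
qed

lemma convergent_of_close:
  fixes F :: "'a \<Rightarrow> 'b::complete_space"
  assumes nt: "\<F> \<noteq> bot"
    and "\<And>e. 0 < e \<Longrightarrow> \<exists>G l'. (G \<longlongrightarrow> l') \<F> \<and> (\<forall>\<^sub>F x in \<F>. dist (F x) (G x) < e)"
  shows "\<exists>l. (F \<longlongrightarrow> l) \<F>"
proof -
  have "\<exists>G l'. (G \<longlongrightarrow> l') \<F> \<and> (\<forall>\<^sub>F x in \<F>. dist (F x) (G x) < inverse (real (Suc N)))" for N
    by (rule assms(2)) simp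
  then obtain G l where G: "\<And>N. (G N \<longlongrightarrow> l N) \<F>"
    "\<And>N. \<forall>\<^sub>F x in \<F>. dist (F x) (G N x) < inverse (real (Suc N))"
    by metis
  have close: "dist (l M) (l N) \<le> inverse (real (Suc M)) + inverse (real (Suc N))" for M N
  proof (rule tendsto_upperbound[OF tendsto_dist[OF G(1) G(1)] _ nt])
    from G(2)[of M] G(2)[of N]
    show "\<forall>\<^sub>F x in \<F>. dist (G M x) (G N x) \<le> inverse (real (Suc M)) + inverse (real (Suc N))"
    proof eventually_elim
      case (elim x)
      then show ?case using dist_triangle3[of "G M x" "G N x" "F x"] by linarith
    qed
  qed
  have small: "\<exists>K. \<forall>N\<ge>K. inverse (real (Suc N)) < e" if "0 < e" for e
    using order_tendstoD(2)[OF LIMSEQ_inverse_real_of_nat that]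
    by (simp add: eventually_sequentially)
  have "Cauchy l"
    unfolding Cauchy_def
  proof (intro allI impI)
    fix e :: real assume "0 < e"
    then obtain K where K: "\<And>N. N \<ge> K \<Longrightarrow> inverse (real (Suc N)) < e / 2"
      using small[of "e / 2"] by auto
    have "dist (l M) (l N) < e" if "M \<ge> K" "N \<ge> K" for M N
      using close[of M N] K[OF that(1)] K[OF that(2)] by linarith
    then show "\<exists>K. \<forall>M\<ge>K. \<forall>N\<ge>K. dist (l M) (l N) < e" by blast
  qed
  then obtain L where L: "l \<longlonglongrightarrow> L"
    using Cauchy_convergent_iff convergent_def by blast
  have "(F \<longlongrightarrow> L) \<F>"
  proof (rule tendsto_of_close)
    fix e :: real assume e: "0 < e"
    obtain K where K: "\<And>N. N \<ge> K \<Longrightarrow> inverse (real (Suc N)) < e" using small[OF e] by blast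
    have "\<forall>\<^sub>F N in sequentially. dist (l N) L < e \<and> K \<le> N"
      using tendstoD[OF L e] eventually_ge_at_top[of K] by (rule eventually_conj)
    then obtain N where N: "dist (l N) L < e" "K \<le> N"
      using eventually_happens trivial_limit_sequentially by blast
    have "\<forall>\<^sub>F x in \<F>. dist (F x) (G N x) < e"
      using G(2)[of N] by eventually_elim (use K[OF N(2)] in simp)
    with N G(1) show "\<exists>G l'. (G \<longlongrightarrow> l') \<F> \<and> dist l' L < e \<and> (\<forall>\<^sub>F x in \<F>. dist (F x) (G x) < e)"
      by blast
  qed
  then show ?thesis by blast
qed

lemma absolutely_integrable_mult_cis:
  fixes f :: "real \<Rightarrow> complex"
  assumes "f absolutely_integrable_on {a..b}"
  shows "(\<lambda>x. f x * cis (c * x)) absolutely_integrable_on {a..b}"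
proof -
  have "(\<lambda>x. cis (c * x) * f x) absolutely_integrable_on {a..b}"
  proof (rule absolutely_integrable_bounded_measurable_product[OF bilinear_times _ _ _ assms])
    show "(\<lambda>x. cis (c * x)) \<in> borel_measurable (lebesgue_on {a..b})"
      by (intro continuous_imp_measurable_on_sets_lebesgue continuous_intros) auto
    show "bounded ((\<lambda>x. cis (c * x)) ` {a..b})"
      by (intro boundedI[of _ 1]) auto
  qed auto
  then show ?thesis by (simp add: mult.commute)
qed

text \<open>
  Multiplication by \<open>cis\<close> preserves moduli, so the Besicovitch distance controls all Fourier
  coefficients at once.  The factor 2 arises because the mean value is taken over \<open>{0..T}\<close> and
  the distance over \<open>{-T..T}\<close>.
\<close>

lemma dist_means_le:
  fixes f g :: "real \<Rightarrow> complex"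
  assumes "f absolutely_integrable_on {-T..T}" "g absolutely_integrable_on {-T..T}" and "0 < T"
  shows "dist ((1 / T) *\<^sub>R integral {0..T} (\<lambda>x. f x * cis (c * x)))
           ((1 / T) *\<^sub>R integral {0..T} (\<lambda>x. g x * cis (c * x)))
         \<le> 2 * (1 / (2 * T) * integral {-T..T} (\<lambda>x. norm (f x - g x)))"
proof -
  have sub: "{0..T} \<subseteq> {-T..T}" using assms(3) by auto
  have diff: "(\<lambda>x. f x - g x) absolutely_integrable_on {-T..T}"
    using assms by (intro set_integral_diff)
  then have diff0: "(\<lambda>x. f x - g x) absolutely_integrable_on {0..T}"
    by (rule absolutely_integrable_on_subinterval[OF _ sub])
  have fg: "f absolutely_integrable_on {0..T}" "g absolutely_integrable_on {0..T}"
    by (rule absolutely_integrable_on_subinterval[OF assms(1) sub],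
        rule absolutely_integrable_on_subinterval[OF assms(2) sub])
  have "integral {0..T} (\<lambda>x. f x * cis (c * x)) - integral {0..T} (\<lambda>x. g x * cis (c * x))
      = integral {0..T} (\<lambda>x. (f x - g x) * cis (c * x))"
    using absolutely_integrable_mult_cis[OF fg(1)] absolutely_integrable_mult_cis[OF fg(2)]
    by (simp add: left_diff_distrib integral_diff absolutely_integrable_on_def)
  also have "norm \<dots> \<le> integral {0..T} (\<lambda>x. norm (f x - g x))"
    using absolutely_integrable_mult_cis[OF diff0] diff0
    by (intro integral_norm_bound_integral) (auto simp: absolutely_integrable_on_def norm_mult)
  also have "\<dots> \<le> integral {-T..T} (\<lambda>x. norm (f x - g x))"
    using diff diff0 by (intro integral_subset_le sub) (auto simp: absolutely_integrable_on_def)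
  finally show ?thesis
    using assms(3)
    by (simp add: dist_norm scaleR_diff_right[symmetric] divide_right_mono)
qed

definition trig_sum :: "nat \<Rightarrow> (nat \<Rightarrow> complex) \<Rightarrow> (nat \<Rightarrow> real) \<Rightarrow> real \<Rightarrow> complex" where
  "trig_sum N a \<mu> x = (\<Sum>k=1..N. a k * cis (\<mu> k * x))"

lemma trig_sum_absolutely_integrable: "trig_sum N a \<mu> absolutely_integrable_on {s..t}"
  unfolding trig_sum_def by (intro absolutely_integrable_continuous_real continuous_intros)

lemma has_mean_trig_sum_mult_cis:
  "has_mean (\<lambda>x. trig_sum N a \<mu> x * cis (- (\<nu> * x))) (\<Sum>k=1..N. if \<mu> k = \<nu> then a k else 0)"
proof -
  have "trig_sum N a \<mu> x * cis (- (\<nu> * x)) = (\<Sum>k=1..N. a k * cis ((\<mu> k - \<nu>) * x))" for x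
    by (simp add: trig_sum_def sum_distrib_right mult.assoc cis_mult left_diff_distrib)
  then show ?thesis
    using has_mean_trig_sum[of "{1..N}" a "\<lambda>k. \<mu> k - \<nu>"] by simp
qed

lemma B_almost_periodic_approx:
  assumes "B_almost_periodic f" "0 < e"
  obtains N a \<mu> where
    "\<forall>\<^sub>F T in at_top. 1 / (2 * T) * integral {-T..T} (\<lambda>x. norm (f x - trig_sum N a \<mu> x)) < e"
proof -
  obtain a \<mu> where "(\<lambda>N. Limsup at_top (\<lambda>T::real. ereal (1 / (2 * T) *
      integral {-T..T} (\<lambda>x. norm (f x - trig_sum N (a N) (\<mu> N) x))))) \<longlonglongrightarrow> 0"
    using assms(1) unfolding B_almost_periodic_def trig_sum_def by blast
  then have "\<forall>\<^sub>F N in sequentially. Limsup at_top (\<lambda>T::real. ereal (1 / (2 * T) *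
      integral {-T..T} (\<lambda>x. norm (f x - trig_sum N (a N) (\<mu> N) x)))) < ereal e"
    using assms(2) by (intro order_tendstoD(2)) auto
  then obtain N where "Limsup at_top (\<lambda>T::real. ereal (1 / (2 * T) *
      integral {-T..T} (\<lambda>x. norm (f x - trig_sum N (a N) (\<mu> N) x)))) < ereal e"
    using eventually_happens trivial_limit_sequentially by blast
  from Limsup_lessD[OF this] that show thesis by simp
qed

lemma has_mean_fourier_coeff:
  assumes "B_almost_periodic f"
  shows "has_mean (\<lambda>x. f x * cis (- (\<nu> * x))) (fourier_coeff f \<nu>)"
proof -
  have int: "f absolutely_integrable_on {a..b}" for a b
    using assms by (simp add: B_almost_periodic_def)
  have "\<exists>m. has_mean (\<lambda>x. f x * cis (- (\<nu> * x))) m"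
    unfolding has_mean_def
  proof (rule convergent_of_close)
    fix e :: real assume "0 < e"
    then obtain N a \<mu> where ev: "\<forall>\<^sub>F T in at_top.
        1 / (2 * T) * integral {-T..T} (\<lambda>x. norm (f x - trig_sum N a \<mu> x)) < e / 2"
      using B_almost_periodic_approx[OF assms, of "e / 2"] by auto
    have "\<forall>\<^sub>F T in at_top. dist ((1 / T) *\<^sub>R integral {0..T} (\<lambda>x. f x * cis (- (\<nu> * x))))
        ((1 / T) *\<^sub>R integral {0..T} (\<lambda>x. trig_sum N a \<mu> x * cis (- (\<nu> * x)))) < e"
      using ev eventually_gt_at_top[of 0]
    proof eventually_elim
      case (elim T)
      then show ?case
        using dist_means_le[OF int trig_sum_absolutely_integrable, of T "-\<nu>" N a \<mu>] by simp
    qed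
    then show "\<exists>G l'. (G \<longlongrightarrow> l') at_top \<and> (\<forall>\<^sub>F T in at_top.
        dist ((1 / T) *\<^sub>R integral {0..T} (\<lambda>x. f x * cis (- (\<nu> * x)))) (G T) < e)"
      using has_mean_trig_sum_mult_cis unfolding has_mean_def by blast
  qed simp
  then show ?thesis
    unfolding fourier_coeff_def using mean_value_eqI by metis
qed

lemma fourier_coeff_diff:
  assumes "B_almost_periodic f" "B_almost_periodic g"
  shows "fourier_coeff (\<lambda>x. f x - g x) \<nu> = fourier_coeff f \<nu> - fourier_coeff g \<nu>"
proof -
  have "(\<lambda>x. h x * cis (- (\<nu> * x))) integrable_on {0..T}" if "B_almost_periodic h" for h :: "real \<Rightarrow> complex" and T
    using that absolutely_integrable_mult_cis[where f = h and a = 0 and b = T and c = "- \<nu>"]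
    by (simp add: B_almost_periodic_def absolutely_integrable_on_def)
  then have "has_mean (\<lambda>x. f x * cis (- (\<nu> * x)) - g x * cis (- (\<nu> * x)))
      (fourier_coeff f \<nu> - fourier_coeff g \<nu>)"
    using assms by (intro has_mean_diff has_mean_fourier_coeff) auto
  then show ?thesis
    by (simp add: fourier_coeff_def[of "\<lambda>x. f x - g x"] left_diff_distrib mean_value_eqI)
qed

lemma fourier_coeff_const:
  assumes "\<nu> \<noteq> 0"
  shows "fourier_coeff (\<lambda>_. c) \<nu> = 0"
  using has_mean_trig_sum[of "{0}" "\<lambda>_. c" "\<lambda>_. - \<nu>"] assms
  by (simp add: fourier_coeff_def mean_value_eqI)

text \<open>
  The tails of \<open>\<Sum>norm (a k)\<close> bound the uniform distance of the series to its partial sums, hence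
  both the Besicovitch distance and the error of the means.  For large \<open>N\<close> the partial sums already
  have the mean values claimed for the series, as each frequency occurs only once.
\<close>

lemma absolutely_convergent_trig_series:
  fixes a :: "nat \<Rightarrow> complex" and \<mu> :: "nat \<Rightarrow> real"
  assumes a: "summable (\<lambda>k. norm (a k))" and inj: "inj \<mu>"
  defines "f \<equiv> \<lambda>x. \<Sum>k. a k * cis (\<mu> k * x)"
  shows "B_almost_periodic f"
    and "fourier_coeff f (\<mu> j) = a j"
    and "\<nu> \<notin> range \<mu> \<Longrightarrow> fourier_coeff f \<nu> = 0"
proof -
  \<comment> \<open>\<open>trig_sum\<close> is indexed from 1, the series from 0.\<close>
  define b where "b k = a (k - 1)" for k
  define \<kappa> where "\<kappa> k = \<mu> (k - 1)" for k
  define R where "R N = (\<Sum>k. norm (a (k + N)))" for N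
  have R: "R \<longlonglongrightarrow> 0" unfolding R_def by (rule suminf_exist_split2[OF a])
  have ts: "trig_sum N b \<kappa> x = (\<Sum>k<N. a k * cis (\<mu> k * x))" for N x
    unfolding trig_sum_def b_def \<kappa>_def
    by (rule sum.reindex_bij_witness[of _ Suc "\<lambda>k. k - 1"]) auto
  have tail: "norm (f x - trig_sum N b \<kappa> x) \<le> R N" for N x
  proof -
    have s: "summable (\<lambda>k. norm (a k * cis (\<mu> k * x)))" using a by (simp add: norm_mult)
    then have "f x - trig_sum N b \<kappa> x = (\<Sum>k. a (k + N) * cis (\<mu> (k + N) * x))"
      unfolding f_def ts by (subst suminf_minus_initial_segment) (auto intro: summable_norm_cancel)
    also have "norm \<dots> \<le> (\<Sum>k. norm (a (k + N) * cis (\<mu> (k + N) * x)))"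
      by (rule summable_norm) (rule summable_ignore_initial_segment[OF s])
    finally show ?thesis by (simp add: R_def norm_mult)
  qed
  have "uniform_limit UNIV (\<lambda>N x. trig_sum N b \<kappa> x) f sequentially"
  proof (rule uniform_limitI)
    fix e :: real assume "0 < e"
    from order_tendstoD(2)[OF R this]
    show "\<forall>\<^sub>F N in sequentially. \<forall>x\<in>UNIV. dist (trig_sum N b \<kappa> x) (f x) < e"
    proof eventually_elim
      case (elim N)
      then show ?case using tail[of _ N] by (auto simp: dist_norm norm_minus_commute intro: le_less_trans)
    qed
  qed
  moreover have "continuous_on UNIV (trig_sum N b \<kappa>)" for N
    unfolding trig_sum_def by (intro continuous_intros)
  ultimately have "continuous_on UNIV f"
    by (intro uniform_limit_theorem[where F = sequentially]) auto
  then have int: "f absolutely_integrable_on {s..t}" for s t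
    using continuous_on_subset absolutely_integrable_continuous_real by blast
  have mean_le: "1 / (2 * T) * integral {-T..T} (\<lambda>x. norm (f x - trig_sum N b \<kappa> x)) \<le> R N"
    and mean_ge: "0 \<le> 1 / (2 * T) * integral {-T..T} (\<lambda>x. norm (f x - trig_sum N b \<kappa> x))"
    if "0 < T" for T N
  proof -
    have i: "(\<lambda>x. norm (f x - trig_sum N b \<kappa> x)) integrable_on {-T..T}"
      using set_integral_diff(1)[OF int trig_sum_absolutely_integrable]
      by (simp add: absolutely_integrable_on_def)
    have "integral {-T..T} (\<lambda>x. norm (f x - trig_sum N b \<kappa> x)) \<le> integral {-T..T} (\<lambda>x. R N)"
      by (intro integral_le i tail integrable_const_ivl)
    then show "1 / (2 * T) * integral {-T..T} (\<lambda>x. norm (f x - trig_sum N b \<kappa> x)) \<le> R N"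
      using that by (simp add: field_simps)
    show "0 \<le> 1 / (2 * T) * integral {-T..T} (\<lambda>x. norm (f x - trig_sum N b \<kappa> x))"
      using that i by (intro mult_nonneg_nonneg integral_nonneg) auto
  qed
  have "(\<lambda>N. Limsup at_top (\<lambda>T::real. ereal (1 / (2 * T) *
      integral {-T..T} (\<lambda>x. norm (f x - trig_sum N b \<kappa> x))))) \<longlonglongrightarrow> 0"
  proof (rule tendsto_sandwich[OF _ _ tendsto_const])
    show "(\<lambda>N. ereal (R N)) \<longlonglongrightarrow> 0"
      using R by (simp add: zero_ereal_def)
    show "\<forall>\<^sub>F N in sequentially. 0 \<le> Limsup at_top (\<lambda>T::real. ereal (1 / (2 * T) *
        integral {-T..T} (\<lambda>x. norm (f x - trig_sum N b \<kappa> x))))"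
      by (intro always_eventually allI le_Limsup eventually_mono[OF eventually_gt_at_top[of 0]])
        (use mean_ge in auto)
    show "\<forall>\<^sub>F N in sequentially. Limsup at_top (\<lambda>T::real. ereal (1 / (2 * T) *
        integral {-T..T} (\<lambda>x. norm (f x - trig_sum N b \<kappa> x)))) \<le> ereal (R N)"
      by (intro always_eventually allI Limsup_bounded eventually_mono[OF eventually_gt_at_top[of 0]])
        (use mean_le in auto)
  qed
  then show "B_almost_periodic f"
    unfolding B_almost_periodic_def trig_sum_def
    using int by (intro conjI allI exI[of _ "\<lambda>_. b"] exI[of _ "\<lambda>_. \<kappa>"]) auto
  have coeff: "fourier_coeff f \<nu> = m"
    if m: "\<forall>\<^sub>F N in sequentially. (\<Sum>k<N. if \<mu> k = \<nu> then a k else 0) = m" for \<nu> m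
  proof -
    have "has_mean (\<lambda>x. f x * cis (- (\<nu> * x))) m"
      unfolding has_mean_def
    proof (rule tendsto_of_close)
      fix e :: real assume "0 < e"
      then have "\<forall>\<^sub>F N in sequentially. R N < e / 2" by (intro order_tendstoD(2)[OF R]) simp
      with m have "\<forall>\<^sub>F N in sequentially. (\<Sum>k<N. if \<mu> k = \<nu> then a k else 0) = m \<and> R N < e / 2"
        by (rule eventually_conj)
      then obtain N where N: "(\<Sum>k<N. if \<mu> k = \<nu> then a k else 0) = m" "R N < e / 2"
        using eventually_happens trivial_limit_sequentially by blast
      have "(\<Sum>k=1..N. if \<kappa> k = \<nu> then b k else 0) = (\<Sum>k<N. if \<mu> k = \<nu> then a k else 0)"
        unfolding b_def \<kappa>_def
        by (rule sum.reindex_bij_witness[of _ Suc "\<lambda>k. k - 1"]) auto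
      then have "has_mean (\<lambda>x. trig_sum N b \<kappa> x * cis (- (\<nu> * x))) m"
        using has_mean_trig_sum_mult_cis[of N b \<kappa> \<nu>] N by simp
      moreover have "\<forall>\<^sub>F T in at_top. dist ((1 / T) *\<^sub>R integral {0..T} (\<lambda>x. f x * cis (- (\<nu> * x))))
          ((1 / T) *\<^sub>R integral {0..T} (\<lambda>x. trig_sum N b \<kappa> x * cis (- (\<nu> * x)))) < e"
        using eventually_gt_at_top[of 0]
      proof eventually_elim
        case (elim T)
        then show ?case
          using dist_means_le[OF int trig_sum_absolutely_integrable elim, of "-\<nu>" N b \<kappa>]
            mean_le[OF elim, of N] N(2) by simp
      qed
      ultimately show "\<exists>G l'. (G \<longlongrightarrow> l') at_top \<and> dist l' m < e \<and> (\<forall>\<^sub>F T in at_top.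
          dist ((1 / T) *\<^sub>R integral {0..T} (\<lambda>x. f x * cis (- (\<nu> * x)))) (G T) < e)"
        using \<open>0 < e\<close> unfolding has_mean_def
        by (intro exI[of _ "\<lambda>T. (1 / T) *\<^sub>R integral {0..T} (\<lambda>x. trig_sum N b \<kappa> x * cis (- (\<nu> * x)))"]
            exI[of _ m]) simp
    qed
    then show ?thesis unfolding fourier_coeff_def by (rule mean_value_eqI)
  qed
  show "fourier_coeff f (\<mu> j) = a j"
    using inj by (intro coeff eventually_mono[OF eventually_gt_at_top[of j]])
      (simp add: inj_eq sum.delta')
  show "fourier_coeff f \<nu> = 0" if "\<nu> \<notin> range \<mu>"
    using that by (intro coeff always_eventually allI sum.neutral) auto
qed

text \<open>
  This produces both the minimizer of the approximation problem (finitely many nonzero \<open>c k\<close>) and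
  the functions that show the constant to be sharp.
\<close>

lemma trig_series_int:
  fixes c :: "int \<Rightarrow> complex" and lam :: "int \<Rightarrow> real"
  assumes "(\<lambda>k. norm (c k)) summable_on UNIV" "inj lam"
  obtains f where "B_almost_periodic f" "\<And>k. fourier_coeff f (lam k) = c k"
    "\<And>\<nu>. \<nu> \<notin> range lam \<Longrightarrow> fourier_coeff f \<nu> = 0"
proof -
  have "(\<lambda>k. norm (c (int_decode k))) summable_on UNIV"
    using assms(1) summable_on_reindex_bij_betw[OF bij_int_decode, of "\<lambda>k. norm (c k)"] by simp
  then have s: "summable (\<lambda>k. norm (c (int_decode k)))"
    by (rule summable_on_imp_summable)
  have inj: "inj (\<lambda>k. lam (int_decode k))"
    using assms(2) inj_int_decode[of UNIV] by (auto simp: inj_def)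
  have r: "range (\<lambda>k. lam (int_decode k)) = range lam"
    using surj_int_decode by (metis image_image)
  define f where "f x = (\<Sum>k. c (int_decode k) * cis (lam (int_decode k) * x))" for x
  note * = absolutely_convergent_trig_series[OF s inj, folded f_def]
  have "fourier_coeff f (lam k) = c k" for k
    using *(2)[of "int_encode k"] by simp
  with that *(1,3) show thesis by (simp add: r)
qed

section \<open>The best approximation\<close>

lemma symmetric_exponents_strict_mono:
  assumes "symmetric_exponents lam"
  shows "strict_mono lam"
proof -
  have pos: "\<And>k. k > 0 \<Longrightarrow> 0 < lam k" "\<And>k. k > 0 \<Longrightarrow> lam k < lam (k + 1)"
    and lam0: "lam 0 = 0" and odd: "\<And>k. lam (- k) = - lam k"
    using assms by (auto simp: symmetric_exponents_def)
  have step: "lam k < lam (k + 1)" for k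
  proof (cases "0 < k \<or> k = 0")
    case True
    then show ?thesis using pos lam0 by auto
  next
    case False
    then have "lam (- (k + 1)) < lam (- k)"
      using pos(1)[of 1] pos(2)[of "- (k + 1)"] lam0 by (cases "k = -1") auto
    then show ?thesis by (simp only: odd)
  qed
  have "lam k < lam (k + 1 + int m)" for k m
  proof (induction m)
    case 0
    then show ?case using step[of k] by simp
  next
    case (Suc m)
    have "k + 1 + int (Suc m) = (k + 1 + int m) + 1" by simp
    then show ?case using Suc.IH step[of "k + 1 + int m"] by (metis order_less_trans)
  qed
  then have "lam k < lam l" if "k < l" for k l
    using that by (metis add.assoc zless_iff_Suc_zadd of_nat_Suc add.commute)
  then show ?thesis by (rule strict_monoI)
qed

lemma BS_finite_iff:
  "BS_finite p f \<longleftrightarrow> (\<lambda>\<mu>. norm (fourier_coeff f \<mu>) powr p) summable_on UNIV"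
  unfolding BS_finite_def
  by (rule summable_on_cong_neutral) (auto simp: fourier_exponents_def)

lemma BS_norm_eq:
  assumes "BS_finite p f"
  shows "BS_norm p f = ennreal ((\<Sum>\<^sub>\<infinity>\<mu>. norm (fourier_coeff f \<mu>) powr p) powr (1 / p))"
proof -
  have "(\<Sum>\<^sub>\<infinity>\<mu>\<in>fourier_exponents f. norm (fourier_coeff f \<mu>) powr p)
      = (\<Sum>\<^sub>\<infinity>\<mu>. norm (fourier_coeff f \<mu>) powr p)"
    by (rule infsum_cong_neutral) (auto simp: fourier_exponents_def)
  then show ?thesis using assms by (simp add: BS_norm_def)
qed

lemma
  assumes "fourier_exponents f \<subseteq> range lam" "inj lam"
  shows BS_finite_iff_range:
      "BS_finite p f \<longleftrightarrow> (\<lambda>k. norm (fourier_coeff f (lam k)) powr p) summable_on UNIV"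
    and infsum_fourier_coeff_range:
      "(\<Sum>\<^sub>\<infinity>\<mu>. norm (fourier_coeff f \<mu>) powr p) = (\<Sum>\<^sub>\<infinity>k. norm (fourier_coeff f (lam k)) powr p)"
proof -
  have z: "norm (fourier_coeff f \<mu>) powr p = 0" if "\<mu> \<notin> range lam" for \<mu>
    using assms(1) that by (auto simp: fourier_exponents_def)
  have "BS_finite p f \<longleftrightarrow> (\<lambda>\<mu>. norm (fourier_coeff f \<mu>) powr p) summable_on range lam"
    unfolding BS_finite_iff by (rule summable_on_cong_neutral) (use z in auto)
  also have "\<dots> \<longleftrightarrow> (\<lambda>k. norm (fourier_coeff f (lam k)) powr p) summable_on UNIV"
    by (simp add: summable_on_reindex[OF assms(2)] o_def)
  finally show "BS_finite p f \<longleftrightarrow> (\<lambda>k. norm (fourier_coeff f (lam k)) powr p) summable_on UNIV" .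
  have "(\<Sum>\<^sub>\<infinity>\<mu>. norm (fourier_coeff f \<mu>) powr p)
      = (\<Sum>\<^sub>\<infinity>\<mu>\<in>range lam. norm (fourier_coeff f \<mu>) powr p)"
    by (rule infsum_cong_neutral) (use z in auto)
  also have "\<dots> = (\<Sum>\<^sub>\<infinity>k. norm (fourier_coeff f (lam k)) powr p)"
    by (simp add: infsum_reindex[OF assms(2)] o_def)
  finally show "(\<Sum>\<^sub>\<infinity>\<mu>. norm (fourier_coeff f \<mu>) powr p)
      = (\<Sum>\<^sub>\<infinity>k. norm (fourier_coeff f (lam k)) powr p)" .
qed

text \<open>
  Subtracting \<open>g\<close> leaves the coefficients of \<open>f\<close> at \<open>lam k\<close>, \<open>n \<le> \<bar>k\<bar>\<close>, unchanged, while the other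
  ones can be removed completely, by the trigonometric polynomial with these very coefficients.
\<close>

lemma best_approx_powr:
  assumes p: "1 \<le> p" and lam: "symmetric_exponents lam" and f: "f \<in> BSp_within p lam"
  shows "best_approx p (lam (int n)) f powr p
    = (\<Sum>\<^sub>\<infinity>k\<in>{k. int n \<le> \<bar>k\<bar>}. norm (fourier_coeff f (lam k)) powr p)"
proof -
  let ?H = "{k. int n \<le> \<bar>k\<bar>}"
  let ?S = "\<Sum>\<^sub>\<infinity>k\<in>?H. norm (fourier_coeff f (lam k)) powr p"
  have mono: "strict_mono lam" by (rule symmetric_exponents_strict_mono[OF lam])
  then have inj: "inj lam" by (rule strict_mono_imp_inj_on)
  have odd: "\<And>k. lam (- k) = - lam k" using lam by (auto simp: symmetric_exponents_def)
  have inside: "lam k \<in> {- lam (int n)<..<lam (int n)} \<longleftrightarrow> \<bar>k\<bar> < int n" for k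
    using strict_mono_less[OF mono] by (auto simp flip: odd)
  have ap: "B_almost_periodic f" and range: "fourier_exponents f \<subseteq> range lam"
    and fin: "BS_finite p f"
    using f by (auto simp: BSp_within_def BSp_def)
  have sum: "(\<lambda>k. norm (fourier_coeff f (lam k)) powr p) summable_on UNIV"
    using fin BS_finite_iff_range[OF range inj] by simp
  then have sumH: "(\<lambda>k. norm (fourier_coeff f (lam k)) powr p) summable_on ?H"
    by (rule summable_on_subset_banach) simp
  have S: "0 \<le> ?S" by (rule infsum_nonneg) simp
  have "(INF g\<in>G_space (lam (int n)). BS_norm p (\<lambda>x. f x - g x)) = ennreal (?S powr (1 / p))"
  proof (rule antisym)
    let ?c = "\<lambda>k. if \<bar>k\<bar> < int n then fourier_coeff f (lam k) else 0"
    have "(\<lambda>k. norm (?c k)) summable_on UNIV \<longleftrightarrow> (\<lambda>k. norm (?c k)) summable_on {- int n..int n}"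
      by (rule summable_on_cong_neutral) auto
    then have csum: "(\<lambda>k. norm (?c k)) summable_on UNIV" by simp
    obtain g where g: "B_almost_periodic g" "\<And>k. fourier_coeff g (lam k) = ?c k"
      "\<And>\<nu>. \<nu> \<notin> range lam \<Longrightarrow> fourier_coeff g \<nu> = 0"
      by (rule trig_series_int[OF csum inj]) (rule that)
    have "\<mu> \<in> {- lam (int n)<..<lam (int n)}" if \<mu>: "fourier_coeff g \<mu> \<noteq> 0" for \<mu>
    proof -
      obtain k where k: "\<mu> = lam k" using g(3) \<mu> by blast
      then have "\<bar>k\<bar> < int n" using g(2) \<mu> by (metis (full_types))
      then show ?thesis unfolding k inside .
    qed
    then have gG: "g \<in> G_space (lam (int n))"
      using g(1) by (auto simp: G_space_def fourier_exponents_def)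
    have d: "fourier_coeff (\<lambda>x. f x - g x) \<mu> = fourier_coeff f \<mu> - fourier_coeff g \<mu>" for \<mu>
      by (rule fourier_coeff_diff[OF ap g(1)])
    have dr: "fourier_exponents (\<lambda>x. f x - g x) \<subseteq> range lam"
      using range g(3) by (force simp: fourier_exponents_def d)
    have dk: "norm (fourier_coeff (\<lambda>x. f x - g x) (lam k)) powr p
        = (if k \<in> ?H then norm (fourier_coeff f (lam k)) powr p else 0)" for k
      by (simp add: d g(2))
    have "(\<lambda>k. norm (fourier_coeff (\<lambda>x. f x - g x) (lam k)) powr p) summable_on UNIV
        \<longleftrightarrow> (\<lambda>k. norm (fourier_coeff f (lam k)) powr p) summable_on ?H"
      unfolding dk by (rule summable_on_cong_neutral) auto
    then have dfin: "BS_finite p (\<lambda>x. f x - g x)"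
      using sumH by (simp add: BS_finite_iff_range[OF dr inj])
    have "(\<Sum>\<^sub>\<infinity>k. norm (fourier_coeff (\<lambda>x. f x - g x) (lam k)) powr p) = ?S"
      unfolding dk by (rule infsum_cong_neutral) auto
    then have "BS_norm p (\<lambda>x. f x - g x) = ennreal (?S powr (1 / p))"
      by (simp add: BS_norm_eq[OF dfin] infsum_fourier_coeff_range[OF dr inj])
    then show "(INF g\<in>G_space (lam (int n)). BS_norm p (\<lambda>x. f x - g x)) \<le> ennreal (?S powr (1 / p))"
      using gG by (metis INF_lower)
  next
    show "ennreal (?S powr (1 / p)) \<le> (INF g\<in>G_space (lam (int n)). BS_norm p (\<lambda>x. f x - g x))"
    proof (rule INF_greatest)
      fix g assume "g \<in> G_space (lam (int n))"
      then have ag: "B_almost_periodic g"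
        and eg: "fourier_exponents g \<subseteq> {- lam (int n)<..<lam (int n)}"
        by (auto simp: G_space_def)
      have d: "fourier_coeff (\<lambda>x. f x - g x) (lam k) = fourier_coeff f (lam k)" if "k \<in> ?H" for k
        using that eg inside[of k] by (auto simp: fourier_coeff_diff[OF ap ag] fourier_exponents_def)
      show "ennreal (?S powr (1 / p)) \<le> BS_norm p (\<lambda>x. f x - g x)"
      proof (cases "BS_finite p (\<lambda>x. f x - g x)")
        case True
        have inj': "inj_on lam ?H" using inj by (rule inj_on_subset) simp
        have s: "(\<lambda>\<mu>. norm (fourier_coeff (\<lambda>x. f x - g x) \<mu>) powr p) summable_on UNIV"
          using True BS_finite_iff by blast
        have "?S = (\<Sum>\<^sub>\<infinity>k\<in>?H. norm (fourier_coeff (\<lambda>x. f x - g x) (lam k)) powr p)"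
          by (rule infsum_cong) (simp only: d)
        also have "\<dots> = (\<Sum>\<^sub>\<infinity>\<mu>\<in>lam ` ?H. norm (fourier_coeff (\<lambda>x. f x - g x) \<mu>) powr p)"
          by (simp add: infsum_reindex[OF inj'] o_def)
        also have "\<dots> \<le> (\<Sum>\<^sub>\<infinity>\<mu>. norm (fourier_coeff (\<lambda>x. f x - g x) \<mu>) powr p)"
          by (rule infsum_mono2[OF summable_on_subset_banach[OF s] s]) auto
        finally have "?S powr (1 / p)
            \<le> (\<Sum>\<^sub>\<infinity>\<mu>. norm (fourier_coeff (\<lambda>x. f x - g x) \<mu>) powr p) powr (1 / p)"
          using S p by (intro powr_mono2) auto
        then show ?thesis by (simp add: BS_norm_eq[OF True] ennreal_leI)
      next
        case False
        then show ?thesis by (simp add: BS_norm_def)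
      qed
    qed
  qed
  then show ?thesis
    using S p by (simp add: best_approx_def powr_powr)
qed

section \<open>Continuity of the modulus of smoothness\<close>

text \<open>
  Needed for the modulus of smoothness: it is monotone in any case, but against an integrator with
  jumps a merely monotone integrand need not be integrable.  The substitution \<open>h = \<delta> * s\<close> moves the
  dependence on \<open>\<delta>\<close> from the index set into the function, where uniform continuity applies.
\<close>

lemma continuous_on_running_Sup:
  fixes G :: "real \<Rightarrow> real"
  assumes G: "continuous_on UNIV G"
  shows "continuous_on {0..R} (\<lambda>\<delta>. SUP h\<in>{h. \<bar>h\<bar> \<le> \<delta>}. G h)"
proof -
  have eq: "(SUP h\<in>{h. \<bar>h\<bar> \<le> \<delta>}. G h) = (SUP s\<in>{-1..1}. G (\<delta> * s))" if "0 \<le> \<delta>" for \<delta>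
  proof -
    have "h \<in> (\<lambda>s. \<delta> * s) ` {-1..1}" if "\<bar>h\<bar> \<le> \<delta>" for h
    proof (cases "\<delta> = 0")
      case True
      then show ?thesis using that by (auto intro!: image_eqI[of _ _ 0])
    next
      case False
      with that \<open>0 \<le> \<delta>\<close> show ?thesis
        by (intro image_eqI[of _ _ "h / \<delta>"]) (auto simp: field_simps)
    qed
    moreover have "\<bar>\<delta> * s\<bar> \<le> \<delta>" if "s \<in> {-1..1}" for s
      using that \<open>0 \<le> \<delta>\<close> by (auto simp: abs_mult abs_le_iff intro!: mult_left_le)
    ultimately have "{h. \<bar>h\<bar> \<le> \<delta>} = (\<lambda>s. \<delta> * s) ` {-1..1}" by auto
    then show ?thesis by (simp add: image_image)
  qed
  have bdd: "bdd_above ((\<lambda>s. G (\<delta> * s)) ` {-1..1})" for \<delta>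
  proof -
    have "continuous_on {-1..1} (\<lambda>s. G (\<delta> * s))"
      by (rule continuous_on_compose2[OF G]) (auto intro!: continuous_intros)
    then show ?thesis
      by (intro bounded_imp_bdd_above compact_imp_bounded compact_continuous_image) auto
  qed
  have "uniformly_continuous_on {-R..R} G"
    by (intro compact_uniformly_continuous continuous_on_subset[OF G]) auto
  then have uc: "\<exists>d>0. \<forall>x\<in>{-R..R}. \<forall>y\<in>{-R..R}. dist y x < d \<longrightarrow> dist (G y) (G x) < e"
    if "0 < e" for e
    using that unfolding uniformly_continuous_on_def by blast
  have "continuous_on {0..R} (\<lambda>\<delta>. SUP s\<in>{-1..1}. G (\<delta> * s))"
    unfolding continuous_on_iff
  proof (intro ballI allI impI)
    fix x e :: real assume x: "x \<in> {0..R}" and e: "0 < e"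
    then obtain d where d: "0 < d"
      "\<And>x y. x \<in> {-R..R} \<Longrightarrow> y \<in> {-R..R} \<Longrightarrow> dist y x < d \<Longrightarrow> dist (G y) (G x) < e / 2"
      using uc[of "e / 2"] by auto
    have le: "(SUP s\<in>{-1..1}. G (y * s)) \<le> (SUP s\<in>{-1..1}. G (z * s)) + e / 2"
      if yz: "y \<in> {0..R}" "z \<in> {0..R}" "dist y z < d" for y z
    proof (rule cSUP_least)
      fix s :: real assume s: "s \<in> {-1..1}"
      then have s1: "\<bar>s\<bar> \<le> 1" by auto
      have small: "\<bar>w * s\<bar> \<le> \<bar>w\<bar>" for w
        using s1 by (simp add: abs_mult mult_left_le)
      have "y * s \<in> {-R..R}" "z * s \<in> {-R..R}"
        using small[of y] small[of z] yz by auto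
      moreover have "dist (y * s) (z * s) < d"
        using small[of "y - z"] yz(3) by (simp add: dist_real_def left_diff_distrib)
      ultimately have "dist (G (y * s)) (G (z * s)) < e / 2" using d(2) by blast
      moreover have "G (z * s) \<le> (SUP s\<in>{-1..1}. G (z * s))" using s bdd by (rule cSUP_upper)
      ultimately show "G (y * s) \<le> (SUP s\<in>{-1..1}. G (z * s)) + e / 2"
        unfolding dist_real_def by linarith
    qed simp
    have "dist (SUP s\<in>{-1..1}. G (y * s)) (SUP s\<in>{-1..1}. G (x * s)) < e"
      if "y \<in> {0..R}" "dist y x < d" for y
      using le[of y x] le[of x y] that x e by (simp add: dist_real_def abs_minus_commute)
    then show "\<exists>d>0. \<forall>y\<in>{0..R}. dist y x < d \<longrightarrow>
        dist (SUP s\<in>{-1..1}. G (y * s)) (SUP s\<in>{-1..1}. G (x * s)) < e"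
      using d(1) by blast
  qed
  then show ?thesis
    by (rule continuous_on_eq) (use eq in auto)
qed

definition smoothness_sum ::
  "(real \<Rightarrow> real) \<Rightarrow> real \<Rightarrow> (int \<Rightarrow> real) \<Rightarrow> (real \<Rightarrow> complex) \<Rightarrow> real \<Rightarrow> real" where
  "smoothness_sum \<phi> p lam f h =
     (\<Sum>\<^sub>\<infinity>k. \<phi> (lam k * h) powr p * norm (fourier_coeff f (lam k)) powr p)"

lemma gen_modulus_eq:
  "gen_modulus \<phi> p lam f \<delta> = (SUP h\<in>{h. \<bar>h\<bar> \<le> \<delta>}. smoothness_sum \<phi> p lam f h powr (1 / p))"
  by (simp add: gen_modulus_def smoothness_sum_def)

lemma Phi_class_bounded:
  assumes "\<phi> \<in> Phi_class"
  obtains B where "0 \<le> B" "\<And>t. \<phi> t \<le> B"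
proof -
  obtain B where "\<And>t. norm (\<phi> t) \<le> B"
    using assms unfolding Phi_class_def bounded_iff by blast
  then have *: "\<phi> t \<le> B" for t by (metis abs_le_D1 real_norm_def)
  moreover have "0 \<le> B" using *[of 0] assms by (simp add: Phi_class_def)
  ultimately show thesis using that by blast
qed

lemma Phi_class_nonneg: "\<phi> \<in> Phi_class \<Longrightarrow> 0 \<le> \<phi> t"
  by (simp add: Phi_class_def)

lemma Phi_class_abs: "\<phi> \<in> Phi_class \<Longrightarrow> \<phi> \<bar>t\<bar> = \<phi> t"
  by (simp add: Phi_class_def abs_if)

lemma continuous_on_Phi_powr:
  fixes u :: "real \<Rightarrow> real"
  assumes \<phi>: "\<phi> \<in> Phi_class" and "0 < p" and "continuous_on A u"
  shows "continuous_on A (\<lambda>t. \<phi> (u t) powr p)"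
proof -
  have "continuous_on A (\<lambda>t. \<phi> (u t))"
    using \<phi> assms(3) by (auto simp: Phi_class_def intro: continuous_on_compose2[of UNIV \<phi>])
  then show ?thesis
    using assms(2) Phi_class_nonneg[OF \<phi>] by (intro continuous_on_powr') auto
qed

context
  fixes p :: real and lam :: "int \<Rightarrow> real" and f :: "real \<Rightarrow> complex" and \<phi> :: "real \<Rightarrow> real"
  assumes p: "1 \<le> p" and \<phi>: "\<phi> \<in> Phi_class"
    and sum: "(\<lambda>k. norm (fourier_coeff f (lam k)) powr p) summable_on UNIV"
begin

lemma smoothness_summable:
  "(\<lambda>k. \<phi> (lam k * h) powr p * norm (fourier_coeff f (lam k)) powr p) summable_on UNIV"
proof -
  obtain B where B: "0 \<le> B" "\<And>t. \<phi> t \<le> B" using \<phi> by (rule Phi_class_bounded) blast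
  show ?thesis
    by (rule summable_on_comparison_test[OF summable_on_cmult_right[OF sum, of "B powr p"]])
      (use B p Phi_class_nonneg[OF \<phi>] in \<open>auto intro!: mult_right_mono powr_mono2\<close>)
qed

lemma smoothness_sum_nonneg: "0 \<le> smoothness_sum \<phi> p lam f h"
  unfolding smoothness_sum_def by (rule infsum_nonneg) simp

lemma continuous_on_smoothness_sum: "continuous_on UNIV (smoothness_sum \<phi> p lam f)"
proof -
  obtain B where B: "0 \<le> B" "\<And>t. \<phi> t \<le> B" using \<phi> by (rule Phi_class_bounded) blast
  let ?g = "\<lambda>k h. \<phi> (lam k * h) powr p * norm (fourier_coeff f (lam k)) powr p"
  have "norm (?g k h) \<le> B powr p * norm (fourier_coeff f (lam k)) powr p" for k h
    using B p Phi_class_nonneg[OF \<phi>] by (auto intro!: mult_right_mono powr_mono2)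
  then have "uniform_limit UNIV (\<lambda>X h. \<Sum>k\<in>X. ?g k h) (\<lambda>h. \<Sum>\<^sub>\<infinity>k. ?g k h) (finite_subsets_at_top UNIV)"
    by (rule Weierstrass_m_test_general[OF _ summable_on_cmult_right[OF sum]])
  moreover have "continuous_on UNIV (\<lambda>h. \<Sum>k\<in>X. ?g k h)" for X
    using p by (intro continuous_intros continuous_on_Phi_powr[OF \<phi>]) auto
  ultimately have "continuous_on UNIV (\<lambda>h. \<Sum>\<^sub>\<infinity>k. ?g k h)"
    by (intro uniform_limit_theorem[where F = "finite_subsets_at_top UNIV"]) auto
  then show ?thesis by (simp add: smoothness_sum_def[abs_def])
qed

lemma continuous_on_smoothness_root:
  "continuous_on A (\<lambda>h. smoothness_sum \<phi> p lam f h powr (1 / p))"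
  using p smoothness_sum_nonneg
  by (intro continuous_on_powr' continuous_on_subset[OF continuous_on_smoothness_sum]) auto

lemma continuous_on_gen_modulus: "continuous_on {0..R} (gen_modulus \<phi> p lam f)"
  unfolding gen_modulus_eq[abs_def]
  by (intro continuous_on_running_Sup continuous_on_smoothness_root)

lemma smoothness_root_le_gen_modulus:
  assumes "\<bar>h\<bar> \<le> \<delta>"
  shows "smoothness_sum \<phi> p lam f h powr (1 / p) \<le> gen_modulus \<phi> p lam f \<delta>"
  unfolding gen_modulus_eq
proof (rule cSUP_upper)
  have "{h. \<bar>h\<bar> \<le> \<delta>} = {-\<delta>..\<delta>}" by auto
  then show "bdd_above ((\<lambda>h. smoothness_sum \<phi> p lam f h powr (1 / p)) ` {h. \<bar>h\<bar> \<le> \<delta>})"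
    by (metis bounded_imp_bdd_above compact_imp_bounded compact_continuous_image compact_Icc
        continuous_on_smoothness_root)
qed (use assms in simp)

lemma gen_modulus_nonneg: "0 \<le> \<delta> \<Longrightarrow> 0 \<le> gen_modulus \<phi> p lam f \<delta>"
  using smoothness_root_le_gen_modulus[of 0 \<delta>] by (rule order_trans[rotated]) simp_all

lemma smoothness_sum_le_gen_modulus:
  assumes "\<bar>h\<bar> \<le> \<delta>"
  shows "smoothness_sum \<phi> p lam f h \<le> gen_modulus \<phi> p lam f \<delta> powr p"
proof -
  have "smoothness_sum \<phi> p lam f h = (smoothness_sum \<phi> p lam f h powr (1 / p)) powr p"
    using p smoothness_sum_nonneg[of h] by (simp add: powr_powr)
  also have "\<dots> \<le> gen_modulus \<phi> p lam f \<delta> powr p"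
    using p by (intro powr_mono2 smoothness_root_le_gen_modulus assms) auto
  finally show ?thesis .
qed

lemma gen_modulus_powr_le:
  assumes "0 \<le> \<delta>" "\<And>h. \<bar>h\<bar> \<le> \<delta> \<Longrightarrow> smoothness_sum \<phi> p lam f h \<le> X"
  shows "gen_modulus \<phi> p lam f \<delta> powr p \<le> X"
proof -
  have X: "0 \<le> X" using assms(2)[of 0] assms(1) smoothness_sum_nonneg[of 0] by simp
  have "gen_modulus \<phi> p lam f \<delta> \<le> X powr (1 / p)"
    unfolding gen_modulus_eq
  proof (rule cSUP_least)
    show "{h. \<bar>h\<bar> \<le> \<delta>} \<noteq> {}" using assms(1) by (auto intro: exI[of _ 0])
    show "smoothness_sum \<phi> p lam f h powr (1 / p) \<le> X powr (1 / p)" if "h \<in> {h. \<bar>h\<bar> \<le> \<delta>}" for h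
      using that p assms(2) smoothness_sum_nonneg by (intro powr_mono2) auto
  qed
  then have "gen_modulus \<phi> p lam f \<delta> powr p \<le> (X powr (1 / p)) powr p"
    using p gen_modulus_nonneg[OF assms(1)] by (intro powr_mono2) auto
  then show ?thesis using p X by (simp add: powr_powr)
qed

end

section \<open>The Jackson-type inequality and its sharpness\<close>

context
  fixes p \<tau> :: real and lam :: "int \<Rightarrow> real" and \<phi> v :: "real \<Rightarrow> real" and n :: nat
  assumes p: "1 \<le> p" and lam: "symmetric_exponents lam" and \<phi>: "\<phi> \<in> Phi_class"
    and \<tau>: "0 < \<tau>" and v: "v \<in> V_class \<tau>" and n: "1 \<le> n"
begin

lemma lam_n_pos: "0 < lam (int n)"
  using lam n by (simp add: symmetric_exponents_def)

lemma v_mono: "mono_on {0..\<tau>} v"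
  using v by (simp add: V_class_def)

lemma BSp_within_summable:
  assumes "f \<in> BSp_within p lam"
  shows "(\<lambda>k. norm (fourier_coeff f (lam k)) powr p) summable_on UNIV"
  using assms strict_mono_imp_inj_on[OF symmetric_exponents_strict_mono[OF lam]]
  by (auto simp: BSp_within_def BSp_def BS_finite_iff_range)

lemma continuous_on_dilated: "continuous_on A (\<lambda>t. \<phi> (c * t / d) powr p)"
  using p unfolding divide_inverse
  by (intro continuous_on_Phi_powr[OF \<phi>] continuous_intros) auto

lemma RS_integral_dilated_nonneg: "0 \<le> RS_integral (\<lambda>t. \<phi> (c * t / d) powr p) v 0 \<tau>"
  using \<tau> by (intro RS_integral_nonneg v_mono continuous_on_dilated) auto

lemma I_const_nonneg: "0 \<le> I_const n \<phi> p lam \<tau> v"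
  unfolding I_const_def by (rule cINF_greatest) (auto intro: RS_integral_dilated_nonneg)

lemma I_const_le:
  assumes "int n \<le> \<bar>k\<bar>"
  shows "I_const n \<phi> p lam \<tau> v \<le> RS_integral (\<lambda>t. \<phi> (lam k * t / lam (int n)) powr p) v 0 \<tau>"
proof -
  have "lam (- k) = - lam k" using lam by (simp add: symmetric_exponents_def)
  moreover have even: "\<phi> (- s) = \<phi> s" for s using \<phi> by (simp add: Phi_class_def)
  ultimately have "(\<lambda>t. \<phi> (lam \<bar>k\<bar> * t / lam (int n)) powr p)
      = (\<lambda>t. \<phi> (lam k * t / lam (int n)) powr p)"
    by (cases "k < 0") auto
  moreover have "I_const n \<phi> p lam \<tau> v
      \<le> RS_integral (\<lambda>t. \<phi> (lam (int (nat \<bar>k\<bar>)) * t / lam (int n)) powr p) v 0 \<tau>"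
    unfolding I_const_def
    by (rule cINF_lower) (use assms RS_integral_dilated_nonneg in \<open>auto intro!: bdd_belowI2[of _ 0]\<close>)
  ultimately show ?thesis by simp
qed

lemma continuous_on_modulus_powr:
  assumes "f \<in> BSp_within p lam"
  shows "continuous_on {0..\<tau>} (\<lambda>t. gen_modulus \<phi> p lam f (t / lam (int n)) powr p)"
proof -
  note sum = BSp_within_summable[OF assms]
  have "continuous_on {0..\<tau>} (\<lambda>t. gen_modulus \<phi> p lam f (t / lam (int n)))"
    using lam_n_pos
    by (intro continuous_on_compose2[OF continuous_on_gen_modulus[OF p \<phi> sum, of "\<tau> / lam (int n)"]]
        continuous_intros) (auto simp: divide_right_mono)
  moreover have "0 \<le> gen_modulus \<phi> p lam f (t / lam (int n))" if "t \<in> {0..\<tau>}" for t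
    using that lam_n_pos by (intro gen_modulus_nonneg[OF p \<phi> sum]) auto
  ultimately show ?thesis using p by (intro continuous_on_powr') auto
qed

lemma modulus_integral_nonneg:
  assumes "f \<in> BSp_within p lam"
  shows "0 \<le> modulus_integral n \<phi> p lam \<tau> v f"
  unfolding modulus_integral_def
  using \<tau> by (intro RS_integral_nonneg v_mono continuous_on_modulus_powr[OF assms]) auto

text \<open>
  The dilated integrals at \<open>lam k\<close>, \<open>n \<le> \<bar>k\<bar>\<close>, are at least \<open>I_const\<close>, and \<open>h = t / lam n\<close> is one of the
  steps over which the modulus takes its supremum.  Arguing with finite partial sums of the Fourier
  energy, only finite sums are exchanged with the integral.  The product form stays meaningful for
  \<open>I_const = 0\<close>.
\<close>

lemma jackson_inequality:
  assumes f: "f \<in> BSp_within p lam"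
  shows "I_const n \<phi> p lam \<tau> v * best_approx p (lam (int n)) f powr p
    \<le> modulus_integral n \<phi> p lam \<tau> v f"
proof -
  let ?H = "{k. int n \<le> \<bar>k\<bar>}"
  let ?a = "\<lambda>k. norm (fourier_coeff f (lam k)) powr p"
  let ?I = "I_const n \<phi> p lam \<tau> v"
  note sum = BSp_within_summable[OF f]
  have "(\<Sum>\<^sub>\<infinity>k\<in>?H. ?I * ?a k) \<le> modulus_integral n \<phi> p lam \<tau> v f"
  proof (rule infsum_le_finite_sums)
    show "(\<lambda>k. ?I * ?a k) summable_on ?H"
      by (intro summable_on_cmult_right summable_on_subset_banach[OF sum]) simp
    fix F assume F: "finite F" "F \<subseteq> ?H"
    let ?g = "\<lambda>k t. \<phi> (lam k * t / lam (int n)) powr p"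
    have "(\<Sum>k\<in>F. ?I * ?a k) \<le> (\<Sum>k\<in>F. ?a k * RS_integral (?g k) v 0 \<tau>)"
      using F(2) by (intro sum_mono, subst mult.commute) (auto intro!: mult_left_mono I_const_le)
    also have "\<dots> = RS_integral (\<lambda>t. \<Sum>k\<in>F. ?a k * ?g k t) v 0 \<tau>"
      using \<tau>
      by (simp add: RS_integral_sum[OF v_mono] RS_integral_cmult[OF v_mono] continuous_on_dilated
          continuous_on_mult_left)
    also have "\<dots> \<le> modulus_integral n \<phi> p lam \<tau> v f"
      unfolding modulus_integral_def
    proof (intro RS_integral_mono v_mono continuous_on_modulus_powr[OF f])
      show "continuous_on {0..\<tau>} (\<lambda>t. \<Sum>k\<in>F. ?a k * ?g k t)"
        by (intro continuous_intros continuous_on_dilated)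
      fix t assume t: "t \<in> {0..\<tau>}"
      have "(\<Sum>k\<in>F. ?a k * ?g k t) \<le> smoothness_sum \<phi> p lam f (t / lam (int n))"
        unfolding smoothness_sum_def
        using finite_sum_le_infsum[OF smoothness_summable[OF p \<phi> sum, of "t / lam (int n)"] F(1)]
        by (simp add: mult.commute)
      also have "\<dots> \<le> gen_modulus \<phi> p lam f (t / lam (int n)) powr p"
        using t lam_n_pos by (intro smoothness_sum_le_gen_modulus[OF p \<phi> sum]) auto
      finally show "(\<Sum>k\<in>F. ?a k * ?g k t) \<le> gen_modulus \<phi> p lam f (t / lam (int n)) powr p" .
    qed (use \<tau> in auto)
    finally show "(\<Sum>k\<in>F. ?I * ?a k) \<le> modulus_integral n \<phi> p lam \<tau> v f" .
  qed
  then show ?thesis by (simp add: best_approx_powr[OF p lam f] infsum_cmult_right')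
qed

text \<open>
  For \<open>e\<^sup>i\<^sup>\<lambda>\<^sup>x\<close> with \<open>\<lambda> = lam n\<close> the modulus at \<open>t / \<lambda>\<close>, \<open>t \<le> \<tau>\<close>, is the supremum of \<open>\<phi>\<close> over \<open>{-t..t}\<close>, that is
  \<open>\<phi> t\<close>, and the best approximation is 1: this is the case of equality.  Since members of
  \<open>BSp_sym\<close> have an exponent at each \<open>\<bar>lam k\<bar>\<close>, terms with coefficients \<open>\<eta> / 2 ^ k\<close> are added.  They can
  only increase the best approximation, and as \<open>norm (c k) powr p \<le> norm (c k)\<close> for coefficients of
  modulus at most 1, their effect on the modulus integral is at most \<open>\<eta>\<close> times a constant.
\<close>

lemma near_extremal:
  assumes mono: "mono_on {0..\<tau>} \<phi>" and \<epsilon>: "0 < \<epsilon>"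
  obtains g where "g \<in> BSp_sym p lam" "\<And>c. \<not> BS_eq g (\<lambda>_. c)"
    "1 \<le> best_approx p (lam (int n)) g"
    "modulus_integral n \<phi> p lam \<tau> v g \<le> RS_integral (\<lambda>t. \<phi> t powr p) v 0 \<tau> + \<epsilon>"
proof -
  have inj: "inj lam"
    by (rule strict_mono_imp_inj_on[OF symmetric_exponents_strict_mono[OF lam]])
  obtain B where B: "0 \<le> B" "\<And>t. \<phi> t \<le> B" using \<phi> by (rule Phi_class_bounded) blast
  define w :: "int \<Rightarrow> real" where "w k = (if 0 < k then (1/2) ^ nat k else 0)" for k
  have w: "w summable_on UNIV"
  proof -
    have "(\<lambda>m. (1/2::real) ^ m) summable_on UNIV"
      by (rule norm_summable_imp_summable_on) (simp add: norm_power)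
    then have "(\<lambda>m. (1/2::real) ^ m) summable_on {0<..}"
      by (rule summable_on_subset_banach) simp
    then have "(w \<circ> int) summable_on {0<..}"
      by (rule summable_on_cong[THEN iffD1, rotated]) (simp add: w_def)
    then have "w summable_on int ` {0<..}"
      by (subst summable_on_reindex) auto
    moreover have "w summable_on UNIV \<longleftrightarrow> w summable_on int ` {0<..}"
    proof (rule summable_on_cong_neutral)
      show "w k = 0" if "k \<in> UNIV - int ` {0<..}" for k
      proof (rule ccontr)
        assume "w k \<noteq> 0"
        then have "0 < k" by (simp add: w_def split: if_splits)
        then have "k = int (nat k)" "nat k \<in> {0<..}" by auto
        with that show False by blast
      qed
    qed auto
    ultimately show ?thesis by blast
  qed
  have w01: "0 \<le> w k" "w k \<le> 1" for k by (auto simp: w_def power_le_one)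
  define W where "W = B powr p * infsum w UNIV * (v \<tau> - v 0)"
  have W: "0 \<le> W"
    unfolding W_def using w01 mono_onD[OF v_mono, of 0 \<tau>] \<tau>
    by (intro mult_nonneg_nonneg infsum_nonneg) auto
  \<comment> \<open>The cap 1 makes \<open>powr p\<close> decrease the coefficients; the rest makes \<open>\<eta> * W \<le> \<epsilon>\<close>.\<close>
  define \<eta> where "\<eta> = min 1 (\<epsilon> / (W + 1))"
  have \<eta>: "0 < \<eta>" "\<eta> \<le> 1" using W \<epsilon> by (auto simp: \<eta>_def)
  have \<eta>W: "\<eta> * W \<le> \<epsilon>"
  proof -
    have "\<eta> * W \<le> \<epsilon> / (W + 1) * W" using W by (intro mult_right_mono) (auto simp: \<eta>_def)
    also have "\<dots> \<le> \<epsilon>" using W \<epsilon> by (simp add: field_simps)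
    finally show ?thesis .
  qed
  define c :: "int \<Rightarrow> complex" where "c k = (if k = int n then 1 else of_real (\<eta> * w k))" for k
  have normc: "norm (c k) = (if k = int n then 1 else \<eta> * w k)" for k
    using \<eta> w01[of k] by (simp add: c_def norm_mult)
  have normc_le: "norm (c k) \<le> (if k = int n then 1 else 0) + \<eta> * w k" for k
    using \<eta> w01[of k] by (auto simp: normc intro!: mult_nonneg_nonneg)
  have delta: "(\<lambda>k. if k = int n then x else 0) summable_on UNIV" 
    and inf_delta: "(\<Sum>\<^sub>\<infinity>k. if k = int n then x else 0) = x" for x :: real
  proof -
    have "((\<lambda>k. if k = int n then x else 0) has_sum x) {int n}"
      using has_sum_finite[of "{int n}" "\<lambda>k. if k = int n then x else 0"] by simp
    then have "((\<lambda>k. if k = int n then x else 0) has_sum x) UNIV"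
      by (subst has_sum_cong_neutral[where T = "{int n}"]) auto
    then show "(\<lambda>k. if k = int n then x else 0) summable_on UNIV"
      "(\<Sum>\<^sub>\<infinity>k. if k = int n then x else 0) = x"
      by (auto intro: has_sum_imp_summable infsumI)
  qed
  have majorant: "(\<lambda>k. (if k = int n then x else 0) + y * w k) summable_on UNIV" for x y
    by (intro summable_on_add delta summable_on_cmult_right w)
  have csum: "(\<lambda>k. norm (c k)) summable_on UNIV"
    by (rule summable_on_comparison_test[OF majorant[of 1 \<eta>]]) (use normc_le in auto)
  obtain g where g: "B_almost_periodic g" "\<And>k. fourier_coeff g (lam k) = c k"
    "\<And>\<nu>. \<nu> \<notin> range lam \<Longrightarrow> fourier_coeff g \<nu> = 0"
    by (rule trig_series_int[OF csum inj]) (rule that)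
  have powr_le: "norm (c k) powr p \<le> \<eta> * w k" if "k \<noteq> int n" for k
  proof -
    have "\<eta> * w k \<le> 1" using \<eta> w01[of k] by (intro mult_le_one) auto
    then have "(\<eta> * w k) powr p \<le> (\<eta> * w k) powr 1"
      using p \<eta> w01[of k] by (intro powr_mono') auto
    then show ?thesis using that \<eta> w01[of k] by (simp add: normc)
  qed
  have sum: "(\<lambda>k. norm (fourier_coeff g (lam k)) powr p) summable_on UNIV"
    unfolding g(2)
    by (rule summable_on_comparison_test[OF majorant[of 1 \<eta>]])
      (use powr_le \<eta> w01 in \<open>auto simp: normc\<close>)
  have range: "fourier_exponents g \<subseteq> range lam"
    using g(3) by (auto simp: fourier_exponents_def)
  have gw: "g \<in> BSp_within p lam"
    using g(1) range sum BS_finite_iff_range[OF range inj] by (simp add: BSp_within_def BSp_def)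
  have pos: "0 < norm (c k)" if "0 < k" for k
    using that \<eta> by (simp add: normc w_def)
  have gs: "g \<in> BSp_sym p lam"
    using gw pos by (auto simp: BSp_sym_def g(2) intro!: add_pos_nonneg)
  have nonconst: "\<not> BS_eq g (\<lambda>_. x)" for x
  proof
    assume "BS_eq g (\<lambda>_. x)"
    then have "c (int n) = fourier_coeff (\<lambda>_. x) (lam (int n))" by (simp add: BS_eq_def flip: g(2))
    then show False using lam_n_pos by (simp add: c_def fourier_coeff_const)
  qed
  have "1 = (\<Sum>k\<in>{int n}. norm (fourier_coeff g (lam k)) powr p)" by (simp add: g(2) normc)
  also have "\<dots> \<le> best_approx p (lam (int n)) g powr p"
    unfolding best_approx_powr[OF p lam gw]
    by (intro finite_sum_le_infsum summable_on_subset_banach[OF sum]) auto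
  finally have "1 powr (1 / p) \<le> (best_approx p (lam (int n)) g powr p) powr (1 / p)"
    using p by (intro powr_mono2) auto
  then have E: "1 \<le> best_approx p (lam (int n)) g"
    using p by (simp add: powr_powr best_approx_def)
  have "modulus_integral n \<phi> p lam \<tau> v g
      \<le> RS_integral (\<lambda>t. \<phi> t powr p + B powr p * (\<eta> * infsum w UNIV)) v 0 \<tau>"
    unfolding modulus_integral_def
  proof (intro RS_integral_mono v_mono continuous_on_modulus_powr[OF gw])
    show "continuous_on {0..\<tau>} (\<lambda>t. \<phi> t powr p + B powr p * (\<eta> * infsum w UNIV))"
      using p by (intro continuous_intros continuous_on_Phi_powr[OF \<phi>]) auto
    fix t assume t: "t \<in> {0..\<tau>}"
    show "gen_modulus \<phi> p lam g (t / lam (int n)) powr p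
        \<le> \<phi> t powr p + B powr p * (\<eta> * infsum w UNIV)"
    proof (rule gen_modulus_powr_le[OF p \<phi> sum])
      show "0 \<le> t / lam (int n)" using t lam_n_pos by simp
      fix h assume h: "\<bar>h\<bar> \<le> t / lam (int n)"
      have "\<bar>lam (int n) * h\<bar> \<le> t"
        using h lam_n_pos by (simp add: abs_mult field_simps)
      then have "\<phi> \<bar>lam (int n) * h\<bar> \<le> \<phi> t"
        using t by (intro mono_onD[OF mono]) auto
      then have hn: "\<phi> (lam (int n) * h) powr p \<le> \<phi> t powr p"
        using p Phi_class_nonneg[OF \<phi>] by (intro powr_mono2) (auto simp: Phi_class_abs[OF \<phi>])
      have "smoothness_sum \<phi> p lam g h
          \<le> (\<Sum>\<^sub>\<infinity>k. (if k = int n then \<phi> t powr p else 0) + B powr p * \<eta> * w k)"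
        unfolding smoothness_sum_def
      proof (rule infsum_mono[OF smoothness_summable[OF p \<phi> sum] majorant])
        fix k
        have "\<phi> (lam k * h) powr p * norm (c k) powr p \<le> B powr p * (\<eta> * w k)" if "k \<noteq> int n"
          using that p B Phi_class_nonneg[OF \<phi>] powr_le
          by (intro mult_mono powr_mono2) auto
        moreover have "0 \<le> B powr p * \<eta> * w k" using \<eta> w01 by simp
        ultimately show "\<phi> (lam k * h) powr p * norm (fourier_coeff g (lam k)) powr p
            \<le> (if k = int n then \<phi> t powr p else 0) + B powr p * \<eta> * w k"
          using hn by (cases "k = int n") (auto simp: g(2) normc mult.assoc)
      qed
      also have "\<dots> = \<phi> t powr p + B powr p * (\<eta> * infsum w UNIV)"
        by (subst infsum_add[OF delta summable_on_cmult_right[OF w]])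
          (simp add: inf_delta infsum_cmult_right' mult.assoc)
      finally show "smoothness_sum \<phi> p lam g h \<le> \<phi> t powr p + B powr p * (\<eta> * infsum w UNIV)" .
    qed
  qed (use \<tau> in auto)
  also have "\<dots> = RS_integral (\<lambda>t. \<phi> t powr p) v 0 \<tau> + \<eta> * W"
    using \<tau> continuous_on_dilated[of "{0..\<tau>}" 1 1]
    by (subst RS_integral_add_const[OF v_mono]) (auto simp: W_def)
  also have "\<dots> \<le> RS_integral (\<lambda>t. \<phi> t powr p) v 0 \<tau> + \<epsilon>" using \<eta>W by simp
  finally show thesis using that gs nonconst E by blast
qed

end

text \<open>
  The limit is taken in \<^typ>\<open>ennreal\<close> so as to include \<open>l = 0\<close>, where the left-hand side is infinite.
\<close>

lemma inverse_le_ennreal_of_approx: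
  fixes C :: ennreal and x :: "nat \<Rightarrow> real"
  assumes x: "x \<longlonglongrightarrow> l" and le: "\<And>N. 1 / ennreal (x N) \<le> C"
  shows "1 / ennreal l \<le> C"
proof (rule LIMSEQ_le_const2)
  have "continuous_on UNIV (\<lambda>y::ennreal. inverse y)"
    by (intro continuous_on_inverse_ennreal continuous_on_id)
  then have "(\<lambda>N. inverse (ennreal (x N))) \<longlonglongrightarrow> inverse (ennreal l)"
    by (rule continuous_on_tendsto_compose) (auto intro: x)
  then show "(\<lambda>N. 1 / ennreal (x N)) \<longlonglongrightarrow> 1 / ennreal l"
    by (simp add: divide_ennreal_def)
  show "\<exists>N. \<forall>m\<ge>N. 1 / ennreal (x m) \<le> C" using le by blast
qed

(* Quotients are taken in ennreal, where x / 0 = \<infinity> for x > 0 and 0 / 0 = 0.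
   The guard of the first claim excludes only the case in which its right-hand side is the
   meaningless product (1 / 0) * 0; this happens just when v jumps at 0 and is constant on
   (0, \<tau>]. *)
theorem mainTheorem1:
  fixes p \<tau> :: real and lam :: "int \<Rightarrow> real" and f :: "real \<Rightarrow> complex"
    and \<phi> v :: "real \<Rightarrow> real" and n :: nat
  assumes "1 \<le> p"
    and "symmetric_exponents lam"
    and "f \<in> BSp_sym p lam"
    and "\<phi> \<in> Phi_class"
    and "0 < \<tau>"
    and "v \<in> V_class \<tau>"
    and "1 \<le> n"
  shows
    "(\<not> (I_const n \<phi> p lam \<tau> v = 0 \<and> modulus_integral n \<phi> p lam \<tau> v f = 0) \<longrightarrow>
        ennreal (best_approx p (lam (int n)) f powr p)
          \<le> 1 / ennreal (I_const n \<phi> p lam \<tau> v) * ennreal (modulus_integral n \<phi> p lam \<tau> v f))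
     \<and>
     (mono_on {0..\<tau>} \<phi> \<and>
      I_const n \<phi> p lam \<tau> v = RS_integral (\<lambda>t. \<phi> t powr p) v 0 \<tau> \<longrightarrow>
        (\<forall>C::ennreal.
           (\<forall>g\<in>BSp_sym p lam.
              ennreal (best_approx p (lam (int n)) g powr p)
                \<le> C * ennreal (modulus_integral n \<phi> p lam \<tau> v g)) \<longrightarrow>
           1 / ennreal (I_const n \<phi> p lam \<tau> v) \<le> C)
        \<and>
        (\<forall>F\<in>{BSp_sym p lam, BSp_within p lam}.
           (SUP g\<in>{g \<in> F. \<forall>c. \<not> BS_eq g (\<lambda>_. c)}.
              ennreal (best_approx p (lam (int n)) g) /
              ennreal (modulus_integral n \<phi> p lam \<tau> v g powr (1 / p)))
           = 1 / ennreal (RS_integral (\<lambda>t. \<phi> t powr p) v 0 \<tau> powr (1 / p))))"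
proof -
  let ?I = "I_const n \<phi> p lam \<tau> v"
  let ?M = "modulus_integral n \<phi> p lam \<tau> v"
  let ?E = "best_approx p (lam (int n))"
  note ctx = assms(1,2,4-7)
  have p: "1 \<le> p" by fact
  have I: "0 \<le> ?I" by (rule I_const_nonneg[OF ctx])
  have M: "0 \<le> ?M g" if "g \<in> BSp_within p lam" for g
    by (rule modulus_integral_nonneg[OF ctx that])
  have main: "?I * ?E g powr p \<le> ?M g" if "g \<in> BSp_within p lam" for g
    by (rule jackson_inequality[OF ctx that])
  have E0: "0 \<le> ?E g" for g by (simp add: best_approx_def)
  have sub: "BSp_sym p lam \<subseteq> BSp_within p lam" by (auto simp: BSp_sym_def)
  have part1: "ennreal (?E f powr p) \<le> 1 / ennreal ?I * ennreal (?M f)"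
    if "\<not> (?I = 0 \<and> ?M f = 0)"
  proof (cases "?I = 0")
    case True
    then have "0 < ?M f" using that M[of f] sub assms(3) by force
    then show ?thesis by (simp add: True ennreal_top_mult)
  next
    case False
    then have "?E f powr p \<le> 1 / ?I * ?M f"
      using main[of f] I sub assms(3) by (auto simp: field_simps)
    then have "ennreal (?E f powr p) \<le> ennreal (1 / ?I) * ennreal (?M f)"
      using I M[of f] sub assms(3) by (subst ennreal_mult[symmetric]) (auto intro: ennreal_leI)
    also have "ennreal (1 / ?I) = 1 / ennreal ?I"
      using False I divide_ennreal[of 1 ?I] by simp
    finally show ?thesis .
  qed
  have part2: "1 / ennreal ?I \<le> C"
    if mono: "mono_on {0..\<tau>} \<phi>" and eq: "?I = RS_integral (\<lambda>t. \<phi> t powr p) v 0 \<tau>"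
      and C: "\<forall>g\<in>BSp_sym p lam. ennreal (?E g powr p) \<le> C * ennreal (?M g)" for C
  proof (rule inverse_le_ennreal_of_approx)
    show "(\<lambda>N. ?I + inverse (real (Suc N))) \<longlonglongrightarrow> ?I"
      using tendsto_add[OF tendsto_const LIMSEQ_inverse_real_of_nat, of ?I] by simp
    fix N
    let ?x = "?I + inverse (real (Suc N))"
    obtain g where g: "g \<in> BSp_sym p lam" "1 \<le> ?E g" "?M g \<le> ?x"
      by (rule near_extremal[OF ctx mono, of "inverse (real (Suc N))"]) (auto simp: eq intro: that)
    have x: "0 < ?x" using I by (simp add: add_nonneg_pos)
    have "1 \<le> ennreal (?E g powr p)" using g(2) p by (simp add: ge_one_powr_ge_zero)
    also have "\<dots> \<le> C * ennreal (?M g)" using C g(1) by blast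
    also have "\<dots> \<le> C * ennreal ?x" using g(3) by (intro mult_left_mono ennreal_leI) auto
    finally have "1 / ennreal ?x \<le> C * ennreal ?x / ennreal ?x" by (rule divide_right_mono_ennreal)
    also have "\<dots> = C" using x by (intro ennreal_mult_divide_eq) auto
    finally show "1 / ennreal ?x \<le> C" .
  qed
  have part3: "(SUP g\<in>{g \<in> F. \<forall>c. \<not> BS_eq g (\<lambda>_. c)}. ennreal (?E g) / ennreal (?M g powr (1 / p)))
      = 1 / ennreal (?I powr (1 / p))" (is "?L = _")
    if mono: "mono_on {0..\<tau>} \<phi>" and eq: "?I = RS_integral (\<lambda>t. \<phi> t powr p) v 0 \<tau>"
      and F: "F \<in> {BSp_sym p lam, BSp_within p lam}" for F
  proof (rule antisym)
    show "?L \<le> 1 / ennreal (?I powr (1 / p))"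
    proof (rule SUP_least)
      fix g assume "g \<in> {g \<in> F. \<forall>c. \<not> BS_eq g (\<lambda>_. c)}"
      then have g: "g \<in> BSp_within p lam" using F sub by auto
      have "(?I * ?E g powr p) powr (1 / p) \<le> ?M g powr (1 / p)"
        using main[OF g] I p by (intro powr_mono2) auto
      then have le: "?I powr (1 / p) * ?E g \<le> ?M g powr (1 / p)"
        using I p E0[of g] by (simp add: powr_mult powr_powr)
      show "ennreal (?E g) / ennreal (?M g powr (1 / p)) \<le> 1 / ennreal (?I powr (1 / p))"
      proof (cases "?I = 0")
        case True
        then show ?thesis by simp
      next
        case False
        then have Ip: "0 < ?I powr (1 / p)" by simp
        show ?thesis
        proof (cases "?M g = 0")
          case True
          then have "?E g = 0" using le Ip E0[of g] by (simp add: mult_le_0_iff)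
          then show ?thesis by simp
        next
          case False
          then have Mp: "0 < ?M g powr (1 / p)" by simp
          have "?E g / ?M g powr (1 / p) \<le> 1 / ?I powr (1 / p)"
            using le Ip Mp by (simp add: field_simps)
          then show ?thesis
            using Ip Mp E0[of g] by (simp add: divide_ennreal flip: ennreal_1)
        qed
      qed
    qed
    show "1 / ennreal (?I powr (1 / p)) \<le> ?L"
    proof (rule inverse_le_ennreal_of_approx)
      have "(\<lambda>N. ?I + inverse (real (Suc N))) \<longlonglongrightarrow> ?I"
        using tendsto_add[OF tendsto_const LIMSEQ_inverse_real_of_nat, of ?I] by simp
      then show "(\<lambda>N. (?I + inverse (real (Suc N))) powr (1 / p)) \<longlonglongrightarrow> ?I powr (1 / p)"
        using p I by (intro tendsto_powr' tendsto_const) auto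
      fix N
      let ?x = "?I + inverse (real (Suc N))"
      obtain g where g: "g \<in> BSp_sym p lam" "\<And>c. \<not> BS_eq g (\<lambda>_. c)" "1 \<le> ?E g" "?M g \<le> ?x"
        by (rule near_extremal[OF ctx mono, of "inverse (real (Suc N))"]) (auto simp: eq intro: that)
      have "0 \<le> ?M g" using M g(1) sub by blast
      then have le: "?M g powr (1 / p) \<le> ?x powr (1 / p)"
        using g(4) p by (intro powr_mono2) auto
      have "0 < ?x" using I by (intro add_nonneg_pos) auto
      then have x: "0 < ?x powr (1 / p)" by simp
      have "1 / ennreal (?x powr (1 / p)) \<le> ennreal (?E g) / ennreal (?M g powr (1 / p))"
      proof (cases "?M g powr (1 / p) = 0")
        case True
        then show ?thesis using g(3) by (simp add: divide_ennreal_def ennreal_mult_top)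
      next
        case False
        then have "0 < ?M g powr (1 / p)" by (simp add: less_le)
        moreover have "1 / ?x powr (1 / p) \<le> ?E g / ?M g powr (1 / p)"
          using calculation g(3) le by (intro frac_le) auto
        ultimately show ?thesis
          using x E0[of g] divide_ennreal[of 1 "?x powr (1 / p)"]
          by (simp add: divide_ennreal ennreal_leI)
      qed
      also have "\<dots> \<le> ?L"
        using g(1,2) F sub by (intro SUP_upper) auto
      finally show "1 / ennreal (?x powr (1 / p)) \<le> ?L" .
    qed
  qed
  show ?thesis
  proof (intro conjI impI allI ballI)
    show "1 / ennreal ?I \<le> C"
      if "mono_on {0..\<tau>} \<phi> \<and> ?I = RS_integral (\<lambda>t. \<phi> t powr p) v 0 \<tau>"
        and "\<forall>g\<in>BSp_sym p lam. ennreal (?E g powr p) \<le> C * ennreal (?M g)" for C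
      by (rule part2[OF conjunct1[OF that(1)] conjunct2[OF that(1)] that(2)])
    show "(SUP g\<in>{g \<in> F. \<forall>c. \<not> BS_eq g (\<lambda>_. c)}. ennreal (?E g) / ennreal (?M g powr (1 / p)))
        = 1 / ennreal (RS_integral (\<lambda>t. \<phi> t powr p) v 0 \<tau> powr (1 / p))"
      if h: "mono_on {0..\<tau>} \<phi> \<and> ?I = RS_integral (\<lambda>t. \<phi> t powr p) v 0 \<tau>"
        and F: "F \<in> {BSp_sym p lam, BSp_within p lam}" for F
      using part3[OF conjunct1[OF h] conjunct2[OF h] F] unfolding conjunct2[OF h] .
  qed (rule part1)
qed

end
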